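(* Every positive definite matrix in $\mathcal{M}_k\otimes\mathcal{M}_m$ belongs to $CR_{k,m}$. Moreover, $CR_{k,m}$ is a convex cone (i.e., $\lambda\gamma\in CR_{k,m}$ and $\gamma+\delta\in CR_{k,m}$ for all $\gamma,\delta\in CR_{k,m}$, $\lambda>0$), it is dense in the set of all states of $\mathcal{M}_k\otimes\mathcal{M}_m$, and it is not closed.
   Context: $\mathcal{M}_k$ denotes the complex $k\times k$ matrices, and $\mathcal{M}_k\otimes\mathcal{M}_m$ is identified with $\mathcal{M}_{km}$ via the Kronecker product. A state is a positive semidefinite Hermitian matrix (not necessarily of trace one). For $\gamma=\sum_{i=1}^nA_i\otimes B_i\in\mathcal{M}_k\otimes\mathcal{M}_m$ define $G_\gamma:\mathcal{M}_k\to\mathcal{M}_m$, $G_\gamma(X)=\sum_i\mathrm{tr}(A_iX)B_i$, and $F_\gamma:\mathcal{M}_m\to\mathcal{M}_k$, $F_\gamma(Y)=\sum_i\mathrm{tr}(B_iY)A_i$. A linear map is positive if it maps positive semidefinite matrices to positive semidefinite matrices, and self-adjoint if self-adjoint with respect to $\langle X,Y\rangle=\mathrm{tr}(XY^* )$. For orthogonal projections $V,W$, $V\mathcal{M}_kW=\{VXW:X\in\mathcal{M}_k\}$. Given an orthogonal projection $V\in\mathcal{M}_k$ and a positive map $T:V\mathcal{M}_kV\to V\mathcal{M}_kV$, $T$ is irreducible if the only orthogonal projections $W$ with $W\mathcal{M}_kW\subseteq V\mathcal{M}_kV$ and $T(W\mathcal{M}_kW)\subseteq W\mathcal{M}_kW$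 are $W=0$ and $W=V$. A self-adjoint positive map $T:\mathcal{M}_k\to\mathcal{M}_k$ is completely reducible if there are orthogonal projections $W_1,\dots,W_l$ with $W_iW_j=0$ for $i\ne j$, $T(W_i\mathcal{M}_kW_i)\subseteq W_i\mathcal{M}_kW_i$ and $T|_{W_i\mathcal{M}_kW_i}$ irreducible for every $i$, and $T|_R\equiv0$, where $R$ is the orthogonal complement (trace inner product) of $\bigoplus_iW_i\mathcal{M}_kW_i$ in $\mathcal{M}_k$. $CR_{k,m}$ is the set of states $\gamma\in\mathcal{M}_k\otimes\mathcal{M}_m$ such that $F_\gamma\circ G_\gamma:\mathcal{M}_k\to\mathcal{M}_k$ is completely reducible.
   Formalization: The claim that CR_{k,m} is not closed is stated only for k, m ≥ 2; for k = 1 or m = 1 every state is in CR_{k,m}, so the set is closed and the claim fails there. All other parts hold for all k, m. *)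

theory Defs
  imports "HOL-Analysis.Analysis"
begin

text \<open>Complex k x k matrices are modelled as complex^'k^'k, with the dimension k = CARD('k)
given by a finite index type. The tensor product M_k (x) M_m, identified with M_km via the
Kronecker product, is modelled as complex^('k*'m)^('k*'m): the entry of gamma at row (a,j),
column (b,l) is the Kronecker entry, i.e. (A (x) B) at ((a,j),(b,l)) = A(a,b) * B(j,l).\<close>

type_synonym 'k cmat = "complex^'k^'k"

definition adj_mat :: "complex^'n::finite^'m::finite \<Rightarrow> complex^'m::finite^'n::finite" where
  "adj_mat A = (\<chi> i j. cnj (A $ j $ i))"

definition kron :: "'k::finite cmat \<Rightarrow> 'm::finite cmat \<Rightarrow> ('k::finite \<times> 'm::finite) cmat" where
  "kron A B = (\<chi> p q. A $ fst p $ fst q * B $ snd p $ snd q)"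

definition tr_inner :: "'k::finite cmat \<Rightarrow> 'k::finite cmat \<Rightarrow> complex" where
  "tr_inner X Y = trace (X ** adj_mat Y)"

definition hermitian_mat :: "'k::finite cmat \<Rightarrow> bool" where
  "hermitian_mat A \<longleftrightarrow> adj_mat A = A"

definition quad_form :: "'k::finite cmat \<Rightarrow> complex^'k::finite \<Rightarrow> complex" where
  "quad_form A x = (\<Sum>i\<in>UNIV. cnj (x $ i) * (A *v x) $ i)"

text \<open>State = positive semidefinite Hermitian matrix (not necessarily trace one).\<close>
definition psd_mat :: "'k::finite cmat \<Rightarrow> bool" where
  "psd_mat A \<longleftrightarrow> hermitian_mat A \<and> (\<forall>x. 0 \<le> Re (quad_form A x))"

definition pd_mat :: "'k::finite cmat \<Rightarrow> bool" where
  "pd_mat A \<longleftrightarrow> hermitian_mat A \<and> (\<forall>x. x \<noteq> 0 \<longrightarrow> 0 < Re (quad_form A x))"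

definition states :: "'k::finite cmat set" where
  "states = {A. psd_mat A}"

text \<open>G_gamma(X) = sum_i tr(A_i X) B_i and F_gamma(Y) = sum_i tr(B_i Y) A_i for
gamma = sum_i A_i (x) B_i, written out entrywise (independent of the decomposition);
see lemmas G_map_kron / F_map_kron below.\<close>
definition G_map :: "('k::finite \<times> 'm::finite) cmat \<Rightarrow> 'k::finite cmat \<Rightarrow> 'm::finite cmat" where
  "G_map \<gamma> X = (\<chi> j l. \<Sum>a\<in>UNIV. \<Sum>b\<in>UNIV. \<gamma> $ (a, j) $ (b, l) * X $ b $ a)"

definition F_map :: "('k::finite \<times> 'm::finite) cmat \<Rightarrow> 'm::finite cmat \<Rightarrow> 'k::finite cmat" where
  "F_map \<gamma> Y = (\<chi> a b. \<Sum>j\<in>UNIV. \<Sum>l\<in>UNIV. \<gamma> $ (a, j) $ (b, l) * Y $ l $ j)"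

lemma G_map_kron: "G_map (kron A B) X = (\<chi> j l. trace (A ** X) * B $ j $ l)"
  by (simp add: G_map_def kron_def trace_def matrix_matrix_mult_def vec_eq_iff
      sum_distrib_left sum_distrib_right mult_ac)

lemma F_map_kron: "F_map (kron A B) Y = (\<chi> a b. trace (B ** Y) * A $ a $ b)"
  apply (simp add: F_map_def kron_def trace_def matrix_matrix_mult_def vec_eq_iff
      sum_distrib_left sum_distrib_right mult_ac)
  done

definition positive_map :: "('k::finite cmat \<Rightarrow> 'k::finite cmat) \<Rightarrow> bool" where
  "positive_map T \<longleftrightarrow> (\<forall>X. psd_mat X \<longrightarrow> psd_mat (T X))"

definition self_adjoint_map :: "('k::finite cmat \<Rightarrow> 'k::finite cmat) \<Rightarrow> bool" where
  "self_adjoint_map T \<longleftrightarrow> (\<forall>X Y. tr_inner (T X) Y = tr_inner X (T Y))"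

definition orth_proj :: "'k::finite cmat \<Rightarrow> bool" where
  "orth_proj P \<longleftrightarrow> hermitian_mat P \<and> P ** P = P"

definition corner :: "'k::finite cmat \<Rightarrow> 'k::finite cmat \<Rightarrow> 'k::finite cmat set" where
  "corner V W = {V ** X ** W | X. True}"

text \<open>Irreducibility of a positive map T restricted to V M_k V (only the values of T on
V M_k V matter).\<close>
definition irreducible_on :: "('k::finite cmat \<Rightarrow> 'k::finite cmat) \<Rightarrow> 'k::finite cmat \<Rightarrow> bool" where
  "irreducible_on T V \<longleftrightarrow>
     (\<forall>W. orth_proj W \<and> corner W W \<subseteq> corner V V \<and> T ` corner W W \<subseteq> corner W W
          \<longrightarrow> W = 0 \<or> W = V)"

definition completely_reducible :: "('k::finite cmat \<Rightarrow> 'k::finite cmat) \<Rightarrow> bool" where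
  "completely_reducible T \<longleftrightarrow>
     self_adjoint_map T \<and> positive_map T \<and>
     (\<exists>Ws :: 'k cmat list.
        (\<forall>i<length Ws. orth_proj (Ws ! i)) \<and>
        (\<forall>i<length Ws. \<forall>j<length Ws. i \<noteq> j \<longrightarrow> Ws ! i ** Ws ! j = 0) \<and>
        (\<forall>i<length Ws. T ` corner (Ws ! i) (Ws ! i) \<subseteq> corner (Ws ! i) (Ws ! i)
                        \<and> irreducible_on T (Ws ! i)) \<and>
        (\<forall>X. (\<forall>i<length Ws. \<forall>Y\<in>corner (Ws ! i) (Ws ! i). tr_inner X Y = 0) \<longrightarrow> T X = 0))"

definition CR :: "('k::finite \<times> 'm::finite) cmat set" where
  "CR = {\<gamma>. psd_mat \<gamma> \<and> completely_reducible (F_map \<gamma> \<circ> G_map \<gamma>)}"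

end

theory Submission
  imports Defs
begin

text \<open>
  Write \<open>T = F\<^sub>\<gamma> \<circ> G\<^sub>\<gamma>\<close>. Since \<open>F\<^sub>\<gamma>\<close> is the adjoint of \<open>G\<^sub>\<gamma>\<close>, the maps \<open>T\<close> and \<open>G\<^sub>\<gamma>\<close>
  have the same kernel. The key point is that \<open>\<gamma>\<close> lies in \<open>CR\<close> iff every orthogonal projection \<open>V\<close>
  whose corner \<open>V M V\<close> is invariant under \<open>T\<close> splits off, i.e. \<open>G\<^sub>\<gamma>\<close> vanishes on \<open>V M (1 - V)\<close>.
  If all invariant corners split off, repeatedly splitting the identity yields the irreducible
  blocks; conversely, given irreducible blocks \<open>W\<^sub>i\<close> and an invariant \<open>V\<close>, irreducibility forces
  \<open>W\<^sub>i \<le> V\<close>, \<open>W\<^sub>i V = 0\<close> or \<open>T W\<^sub>i = 0\<close>.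

  By positivity, \<open>V M V\<close> is invariant iff \<open>T V\<close> is supported in \<open>V\<close>. As
  \<open>T\<^bsub>\<gamma>+\<delta>\<^esub> V\<close> dominates \<open>T\<^sub>\<gamma> V\<close> and \<open>T\<^sub>\<delta> V\<close>, an invariant corner for \<open>\<gamma> + \<delta>\<close> is invariant
  for \<open>\<gamma>\<close> and for \<open>\<delta>\<close>, so the splitting property is inherited by sums. For positive definite \<open>\<gamma>\<close>
  only \<open>V = 0\<close> and \<open>V = 1\<close> are invariant. Density follows by adding small multiples of the
  identity, and a maximally entangled state of two qubits is a limit point outside \<open>CR\<close>.
\<close>

section \<open>Complex matrices and positive semidefiniteness\<close>

lemma matrix_mult_simps:
  fixes A B C :: "'k::finite cmat"
  shows matrix_mult_add_left: "(A + B) ** C = A ** C + B ** C"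
    and matrix_mult_add_right: "A ** (B + C) = A ** B + A ** C"
    and matrix_mult_diff_left: "(A - B) ** C = A ** C - B ** C"
    and matrix_mult_diff_right: "A ** (B - C) = A ** B - A ** C"
    and matrix_mult_zero_left: "0 ** C = (0 :: 'k cmat)"
    and matrix_mult_zero_right: "C ** 0 = (0 :: 'k cmat)"
  by (simp_all add: matrix_matrix_mult_def vec_eq_iff algebra_simps sum.distrib sum_subtractf)

lemma matrix_mult_sum_left:
  fixes f :: "'i \<Rightarrow> 'k::finite cmat" and A :: "'k cmat"
  shows "(\<Sum>i\<in>I. f i) ** A = (\<Sum>i\<in>I. f i ** A)"
  by (induction I rule: infinite_finite_induct) (simp_all add: matrix_mult_simps)

lemma matrix_mult_sum_right:
  fixes f :: "'i \<Rightarrow> 'k::finite cmat" and A :: "'k cmat"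
  shows "A ** (\<Sum>i\<in>I. f i) = (\<Sum>i\<in>I. A ** f i)"
  by (induction I rule: infinite_finite_induct) (simp_all add: matrix_mult_simps)

lemma mat_mult_entry: "(mat c ** (A :: 'k::finite cmat)) $ i $ j = c * A $ i $ j"
  by (simp add: matrix_matrix_mult_def mat_def if_distrib[of "\<lambda>x. x * _"] cong: if_cong)

lemma mat_commute: "(A :: 'k::finite cmat) ** mat c = mat c ** A"
  by (simp add: vec_eq_iff mat_mult_entry)
     (simp add: matrix_matrix_mult_def mat_def if_distrib[of "\<lambda>x. _ * x"] cong: if_cong)

lemma adj_mat_simps:
  fixes A B :: "'k::finite cmat"
  shows adj_mat_add: "adj_mat (A + B) = adj_mat A + adj_mat B"
    and adj_mat_diff: "adj_mat (A - B) = adj_mat A - adj_mat B"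
    and adj_mat_mult: "adj_mat (A ** B) = adj_mat B ** adj_mat A"
    and adj_mat_scaleR: "adj_mat (r *\<^sub>R A) = r *\<^sub>R adj_mat A"
    and adj_mat_adj_mat: "adj_mat (adj_mat A) = A"
    and adj_mat_mat: "adj_mat (mat c) = (mat (cnj c) :: 'k cmat)"
    and adj_mat_zero: "adj_mat 0 = (0 :: 'k cmat)"
  by (auto simp: adj_mat_def vec_eq_iff matrix_matrix_mult_def mat_def mult.commute)

lemma mat_scaleR: "mat (of_real r) ** (A :: 'k::finite cmat) = r *\<^sub>R A"
  by (simp add: vec_eq_iff mat_mult_entry) (simp add: scaleR_conv_of_real)

section \<open>Inner product of vectors and quadratic forms\<close>

definition cip :: "complex^'k::finite \<Rightarrow> complex^'k \<Rightarrow> complex" where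
  "cip x y = (\<Sum>i\<in>UNIV. cnj (x $ i) * y $ i)"

lemma cip_simps:
  shows cip_add_left: "cip (x + y) z = cip x z + cip y z"
    and cip_add_right: "cip x (y + z) = cip x y + cip x z"
    and cip_diff_left: "cip (x - y) z = cip x z - cip y z"
    and cip_diff_right: "cip x (y - z) = cip x y - cip x z"
    and cip_smult_left: "cip (c *s x) y = cnj c * cip x y"
    and cip_smult_right: "cip x (c *s y) = c * cip x y"
    and cip_zero_left: "cip 0 x = 0"
    and cip_zero_right: "cip x 0 = 0"
  by (simp_all add: cip_def algebra_simps sum.distrib sum_subtractf sum_distrib_left)

lemma cnj_cip: "cnj (cip x y) = cip y x"
  by (simp add: cip_def mult.commute)

lemma cip_self: "cip x x = of_real ((norm x)\<^sup>2)"
proof -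
  have "cip x x = (\<Sum>i\<in>UNIV. of_real ((norm (x $ i))\<^sup>2))"
    unfolding cip_def by (intro sum.cong refl) (metis complex_norm_square mult.commute of_real_power)
  also have "\<dots> = of_real ((norm x)\<^sup>2)"
    by (simp add: norm_vec_def L2_set_def sum_nonneg)
  finally show ?thesis .
qed

lemma cip_adj_mat: "cip (adj_mat A *v x) y = cip x (A *v y)"
  unfolding cip_def adj_mat_def matrix_vector_mult_def
  by (simp add: sum_distrib_left sum_distrib_right mult_ac) (rule sum.swap)

lemma cip_hermitian: "hermitian_mat A \<Longrightarrow> cip (A *v x) y = cip x (A *v y)"
  by (metis cip_adj_mat hermitian_mat_def)

lemma quad_form_cip: "quad_form A x = cip x (A *v x)"
  by (simp add: quad_form_def cip_def)

lemma quad_form_simps: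
  fixes A B :: "'k::finite cmat"
  shows quad_form_add: "quad_form (A + B) x = quad_form A x + quad_form B x"
    and quad_form_diff: "quad_form (A - B) x = quad_form A x - quad_form B x"
    and quad_form_scaleR: "quad_form (r *\<^sub>R A) x = of_real r * quad_form A x"
    and quad_form_zero: "quad_form 0 x = 0"
    and quad_form_mat_1: "quad_form (mat 1) x = of_real ((norm x)\<^sup>2)"
proof -
  show "quad_form (r *\<^sub>R A) x = of_real r * quad_form A x"
    by (simp add: quad_form_def matrix_vector_mult_def sum_distrib_left)
       (simp add: scaleR_conv_of_real mult_ac)
qed (simp_all add: quad_form_cip algebra_simps cip_simps cip_self)

lemma quad_form_congruence:
  fixes A S :: "'k::finite cmat"
  shows "quad_form (adj_mat S ** A ** S) x = quad_form A (S *v x)"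
proof -
  have "quad_form A (S *v x) = cip x (adj_mat S *v (A *v (S *v x)))"
    by (metis adj_mat_adj_mat cip_adj_mat quad_form_cip)
  thus ?thesis by (simp add: quad_form_cip matrix_vector_mul_assoc matrix_mul_assoc)
qed

definition outer :: "complex^'k::finite \<Rightarrow> 'k cmat" where
  "outer x = (\<chi> i j. x $ i * cnj (x $ j))"

lemma outer_mult_vec: "outer x *v y = cip x y *s x"
  by (simp add: outer_def cip_def matrix_vector_mult_def vec_eq_iff sum_distrib_left mult_ac)

lemma quad_form_outer: "quad_form (outer x) y = of_real ((norm (cip x y))\<^sup>2)"
proof -
  have "quad_form (outer x) y = cip x y * cnj (cip x y)"
    by (simp add: quad_form_cip outer_mult_vec cip_simps cnj_cip)
  thus ?thesis by (metis complex_norm_square)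
qed

lemma trace_mult_outer: "trace (A ** outer x) = quad_form A x"
  by (simp add: trace_def outer_def quad_form_def matrix_matrix_mult_def matrix_vector_mult_def
      sum_distrib_left mult_ac)

lemma hermitian_mat_simps:
  fixes A B S :: "'k::finite cmat"
  shows hermitian_mat_add: "hermitian_mat A \<Longrightarrow> hermitian_mat B \<Longrightarrow> hermitian_mat (A + B)"
    and hermitian_mat_diff: "hermitian_mat A \<Longrightarrow> hermitian_mat B \<Longrightarrow> hermitian_mat (A - B)"
    and hermitian_mat_scaleR: "hermitian_mat A \<Longrightarrow> hermitian_mat (r *\<^sub>R A)"
    and hermitian_mat_congruence: "hermitian_mat A \<Longrightarrow> hermitian_mat (adj_mat S ** A ** S)"
    and hermitian_mat_outer: "hermitian_mat (outer x)"
    and hermitian_mat_zero: "hermitian_mat 0"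
    and hermitian_mat_mat_1: "hermitian_mat (mat 1)"
  by (simp_all add: hermitian_mat_def adj_mat_simps matrix_mul_assoc)
     (simp add: adj_mat_def outer_def vec_eq_iff)

lemma psd_mat_hermitian: "psd_mat A \<Longrightarrow> hermitian_mat A"
  by (simp add: psd_mat_def)

lemma psd_mat_simps:
  fixes A B S :: "'k::finite cmat"
  shows psd_mat_add: "psd_mat A \<Longrightarrow> psd_mat B \<Longrightarrow> psd_mat (A + B)"
    and psd_mat_scaleR: "psd_mat A \<Longrightarrow> 0 \<le> r \<Longrightarrow> psd_mat (r *\<^sub>R A)"
    and psd_mat_congruence: "psd_mat A \<Longrightarrow> psd_mat (adj_mat S ** A ** S)"
    and psd_mat_outer: "psd_mat (outer x)"
    and psd_mat_zero: "psd_mat 0"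
    and psd_mat_mat_1: "psd_mat (mat 1)"
  by (auto simp: psd_mat_def hermitian_mat_simps quad_form_simps quad_form_congruence quad_form_outer)

lemma psd_mat_sum: "(\<And>i. i \<in> I \<Longrightarrow> psd_mat (f i)) \<Longrightarrow> psd_mat (\<Sum>i\<in>I. f i)"
  by (induction I rule: infinite_finite_induct) (auto simp: psd_mat_zero psd_mat_add)

text \<open>If \<open>A *v x\<close> were nonzero, a short move from \<open>x\<close> in the
  direction of \<open>- (A *v x)\<close> would make the form negative, because its first-order
  change is negative.\<close>

lemma psd_mat_kernel:
  assumes "psd_mat A" "Re (quad_form A x) \<le> 0"
  shows "A *v x = 0"
proof (rule ccontr)
  assume nz: "A *v x \<noteq> 0"
  define y where "y = A *v x"
  define N where "N = (norm y)\<^sup>2"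
  define q where "q = Re (quad_form A y)"
  \<comment> \<open>The form at \<open>x - t y\<close> is at most
    \<open>- 2 * t * N + t^2 * q\<close>. This step length makes the bound negative, and the
    \<open>+ 1\<close> covers the case \<open>q = 0\<close>.\<close>
  define t where "t = N / (q + 1)"
  have N: "N > 0" using nz by (simp add: N_def y_def)
  have q: "q \<ge> 0" using assms(1) by (simp add: psd_mat_def q_def)
  have "0 \<le> Re (quad_form A (x - of_real t *s y))" using assms(1) by (simp add: psd_mat_def)
  also have "quad_form A (x - of_real t *s y) =
      quad_form A x - of_real t * cip x (A *v y) - of_real t * cip y (A *v x) + of_real (t^2) * quad_form A y"
    by (simp add: quad_form_cip algebra_simps cip_simps vec.scale power2_eq_square)
  also have "cip x (A *v y) = of_real N"
    by (metis N_def assms(1) cip_hermitian cip_self psd_mat_hermitian y_def)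
  also have "cip y (A *v x) = of_real N"
    by (metis N_def cip_self y_def)
  finally have "0 \<le> - 2 * t * N + t^2 * q"
    using assms(2) by (simp add: q_def mult.commute)
  also have "\<dots> = - (N^2 * (q + 2) / (q + 1)^2)"
    using q by (simp add: t_def divide_simps power2_eq_square) (simp add: algebra_simps)
  also have "\<dots> < 0" using N q by simp
  finally show False by simp
qed

text \<open>From 0 \<le> A \<le> B the kernel of B lies in the kernel of A, and
  \<open>B ** V = B\<close> puts every vector x - V x into the kernel of B. The equation
  \<open>A ** V = A\<close> is the algebraic form, used throughout, of A being supported in
  V.\<close>

lemma psd_mat_le_support:
  assumes "psd_mat A" "psd_mat (B - A)" "B ** V = B"
  shows "A ** V = A"
proof -
  have "A *v (x - V *v x) = 0" for x
  proof (rule psd_mat_kernel[OF assms(1)])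
    have "B *v (x - V *v x) = 0"
      by (simp add: algebra_simps matrix_vector_mul_assoc assms(3))
    hence "quad_form B (x - V *v x) = 0" by (simp add: quad_form_cip cip_simps)
    thus "Re (quad_form A (x - V *v x)) \<le> 0"
      using assms(2) by (auto simp: psd_mat_def quad_form_simps dest!: spec[of _ "x - V *v x"])
  qed
  thus ?thesis
    by (simp add: matrix_eq algebra_simps matrix_vector_mul_assoc[symmetric])
qed

lemma hermitian_support_left:
  assumes "hermitian_mat A" "hermitian_mat V" "A ** V = A"
  shows "V ** A = A"
  by (metis adj_mat_mult assms hermitian_mat_def)

lemma psd_mat_diag_nonneg: "psd_mat A \<Longrightarrow> 0 \<le> Re (A $ i $ i)"
proof -
  have "quad_form A (axis i 1) = A $ i $ i"
    by (simp add: quad_form_def matrix_vector_mult_def axis_def if_distrib[of "\<lambda>x. _ * x"]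
       if_distrib[of cnj] if_distrib[of "\<lambda>x. x * _"] cong: if_cong)
  thus "psd_mat A \<Longrightarrow> 0 \<le> Re (A $ i $ i)" by (metis psd_mat_def)
qed

lemma matrix_vector_axis: "((A :: 'k::finite cmat) *v axis i 1) $ a = A $ a $ i"
  by (simp add: matrix_vector_mult_def axis_def if_distrib[of "\<lambda>x. _ * x"] cong: if_cong)

lemma cip_axis: "cip (axis i 1) x = x $ i"
  by (simp add: cip_def axis_def if_distrib[of "\<lambda>x. x * _"] if_distrib[of cnj] cong: if_cong)

lemma psd_mat_zero_diag:
  assumes "psd_mat A" "A $ i $ i = 0"
  shows "A *v axis i 1 = 0"
  using assms by (intro psd_mat_kernel) (simp_all add: quad_form_cip cip_axis matrix_vector_axis)

text \<open>One step of the Cholesky algorithm: subtracting the right rank-one matrix from a positive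
  matrix leaves a positive matrix (a Schur complement) with one more zero column.\<close>

lemma psd_mat_schur_step:
  assumes psd: "psd_mat A" and nz: "A $ i $ i \<noteq> 0"
  obtains v B where "psd_mat B" "A = B + outer v" "B *v axis i 1 = 0"
    "\<And>j. A *v axis j 1 = 0 \<Longrightarrow> B *v axis j 1 = 0"
proof -
  define d where "d = Re (A $ i $ i)"
  have herm: "A $ a $ b = cnj (A $ b $ a)" for a b
    using psd_mat_hermitian[OF psd] by (simp add: hermitian_mat_def adj_mat_def vec_eq_iff)
  have Aii: "A $ i $ i = of_real d"
    using herm[of i i] by (simp add: d_def complex_eq_iff)
  have "d \<noteq> 0" using nz Aii by auto
  hence d: "d > 0" using psd_mat_diag_nonneg[OF psd, of i] unfolding d_def by linarith
  define v where "v = (1 / of_real (sqrt d) :: complex) *s (A *v axis i 1)"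
  define B where "B = A - outer v"
  have vv: "v $ a * cnj (v $ b) = A $ a $ i * A $ i $ b / of_real d" for a b
  proof -
    have "v $ a * cnj (v $ b) = A $ a $ i * cnj (A $ b $ i) / (of_real (sqrt d) * of_real (sqrt d))"
      by (simp add: v_def matrix_vector_axis)
    also have "of_real (sqrt d) * of_real (sqrt d) = (of_real d :: complex)"
      using d by (simp flip: of_real_mult)
    finally show ?thesis using herm[of i b] by simp
  qed
  have Bent: "B $ a $ b = A $ a $ b - A $ a $ i * A $ i $ b / of_real d" for a b
    by (simp add: B_def outer_def vv)
  have "hermitian_mat B"
    unfolding B_def by (intro hermitian_mat_diff hermitian_mat_outer psd_mat_hermitian psd)
  moreover have "0 \<le> Re (quad_form B x)" for x
  proof -
    \<comment> \<open>Completing the square: this coefficient minimises the form of \<open>A\<close>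
      along the line from \<open>x\<close> in direction \<open>e\<close>, and the minimum is the
      form of \<open>B\<close> at \<open>x\<close>.\<close>
    define c where "c = (A *v x) $ i / of_real d"
    define e where "e = (axis i 1 :: complex^'a)"
    have Axe: "cip e (A *v x) = of_real d * c" using d by (simp add: e_def c_def cip_axis)
    have "cip x (A *v e) = cnj (cip e (A *v x))"
      using psd cip_hermitian cnj_cip psd_mat_hermitian by metis
    hence Axe': "cip x (A *v e) = of_real d * cnj c" by (simp add: Axe)
    have Aee: "cip e (A *v e) = of_real d"
      by (simp add: e_def cip_axis matrix_vector_axis Aii)
    have ve: "v = (1 / of_real (sqrt d)) *s (A *v e)" by (simp add: v_def e_def)
    have "cip v x = cip e (A *v x) / of_real (sqrt d)"
      by (simp add: ve cip_simps cip_hermitian[OF psd_mat_hermitian[OF psd]])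
    hence "cip v x * cnj (cip v x) = of_real d * c * (of_real d * cnj c) / (of_real (sqrt d) * of_real (sqrt d))"
      by (simp add: Axe)
    also have "of_real (sqrt d) * of_real (sqrt d) = (of_real d :: complex)"
      using d by (simp flip: of_real_mult)
    finally have 1: "cip v x * cnj (cip v x) = of_real d * c * cnj c" using d by simp
    have "quad_form A (x - c *s e) =
       quad_form A x - c * cip x (A *v e) - cnj c * cip e (A *v x) + c * cnj c * cip e (A *v e)"
      by (simp add: quad_form_cip algebra_simps cip_simps vec.scale)
    also have "\<dots> = quad_form A x - of_real d * c * cnj c"
      by (simp add: Axe Axe' Aee)
    also have "\<dots> = quad_form B x"
      unfolding B_def quad_form_diff 1[symmetric]
      by (simp add: quad_form_cip outer_mult_vec cip_simps cnj_cip)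
    finally show ?thesis using psd by (metis psd_mat_def)
  qed
  ultimately have "psd_mat B" by (simp add: psd_mat_def)
  moreover have "A = B + outer v" by (simp add: B_def)
  moreover have "B *v axis i 1 = 0"
    using d by (simp add: vec_eq_iff matrix_vector_axis Bent Aii)
  moreover have "B *v axis j 1 = 0" if "A *v axis j 1 = 0" for j
    using that by (simp add: vec_eq_iff matrix_vector_axis Bent)
  ultimately show ?thesis using that by blast
qed

text \<open>Takes the place of a spectral decomposition: claims that are additive in a positive
  matrix reduce to rank one. Each Schur step lowers the number of nonzero columns, and it is
  available unless the diagonal, and hence the matrix, is zero.\<close>

lemma psd_mat_induct [consumes 1, case_names zero add]:
  assumes "psd_mat A"
    and zero: "P 0"
    and add: "\<And>B v. psd_mat B \<Longrightarrow> P B \<Longrightarrow> P (B + outer v)"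
  shows "P A"
  using assms(1)
proof (induction "card {i. A *v axis i 1 \<noteq> 0}" arbitrary: A rule: less_induct)
  case less
  show ?case
  proof (cases "\<forall>i. A $ i $ i = 0")
    case True
    hence "A *v axis i 1 = 0" for i using psd_mat_zero_diag less.prems by blast
    hence "A $ a $ i = 0" for a i by (metis matrix_vector_axis zero_index)
    hence "A = 0" by (simp add: vec_eq_iff)
    thus ?thesis using zero by simp
  next
    case False
    then obtain i where i: "A $ i $ i \<noteq> 0" by blast
    obtain v B where B: "psd_mat B" "A = B + outer v" "B *v axis i 1 = 0"
      "\<And>j. A *v axis j 1 = 0 \<Longrightarrow> B *v axis j 1 = 0"
      using psd_mat_schur_step[OF less.prems i] by metis
    have "A *v axis i 1 \<noteq> 0" using i matrix_vector_axis by (metis zero_index)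
    hence "{i. B *v axis i 1 \<noteq> 0} \<subset> {i. A *v axis i 1 \<noteq> 0}" using B by blast
    hence "card {i. B *v axis i 1 \<noteq> 0} < card {i. A *v axis i 1 \<noteq> 0}"
      by (intro psubset_card_mono) auto
    thus ?thesis using less.hyps B add by blast
  qed
qed

section \<open>Positivity of the trace pairing\<close>

lemma trace_zero: "trace (0 :: 'k::finite cmat) = 0"
  by (simp add: trace_def)

lemma trace_mult_psd_nonneg:
  assumes "psd_mat X" "psd_mat A"
  shows "0 \<le> Re (trace (A ** X))"
  using assms(1)
proof (induction rule: psd_mat_induct)
  case (add B v)
  thus ?case using assms(2)
    by (simp add: matrix_mult_simps trace_add trace_mult_outer psd_mat_def)
qed (simp add: matrix_mult_simps trace_zero)

lemma trace_mult_pd_pos: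
  assumes "psd_mat X" "pd_mat A" "X \<noteq> 0"
  shows "0 < Re (trace (A ** X))"
proof -
  \<comment> \<open>The alternative \<open>X = 0\<close> belongs to the induction claim, since the
    induction starts at 0 and may add the outer product of the zero vector.\<close>
  have "X = 0 \<or> 0 < Re (trace (A ** X))"
    using assms(1)
  proof (induction rule: psd_mat_induct)
    case (add B v)
    have v: "v = 0 \<or> 0 < Re (quad_form A v)" using assms(2) by (auto simp: pd_mat_def)
    have "outer v = 0" if "v = 0" using that by (simp add: outer_def vec_eq_iff)
    moreover have "quad_form A v = 0" if "v = 0" using that by (simp add: quad_form_cip cip_simps)
    ultimately show ?case using add v
      by (auto simp: matrix_mult_simps trace_add trace_mult_outer trace_zero)
  qed simp
  thus ?thesis using assms(3) by blast
qed

lemma pd_imp_psd_mat: "pd_mat A \<Longrightarrow> psd_mat A"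
  unfolding pd_mat_def psd_mat_def by (metis quad_form_cip cip_zero_left less_eq_real_def zero_complex.simps(1))

lemma tr_inner_self_eq_0: "tr_inner X X = 0 \<longleftrightarrow> X = 0"
proof -
  have eq: "tr_inner X X = of_real (\<Sum>i\<in>UNIV. \<Sum>j\<in>UNIV. (norm (X $ i $ j))\<^sup>2)"
    by (simp add: tr_inner_def trace_def matrix_matrix_mult_def adj_mat_def
        complex_norm_square del: of_real_power)
  show ?thesis
    unfolding eq of_real_eq_0_iff
    by (subst sum_nonneg_eq_0_iff; simp add: sum_nonneg)
       (simp add: sum_nonneg_eq_0_iff vec_eq_iff)
qed

section \<open>Orthogonal projections\<close>

lemma orth_proj_hermitian: "orth_proj V \<Longrightarrow> hermitian_mat V"
  and orth_proj_idem: "orth_proj V \<Longrightarrow> V ** V = V"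
  by (simp_all add: orth_proj_def)

lemma orth_proj_idem_vec: "orth_proj V \<Longrightarrow> V *v (V *v x) = V *v x"
  by (simp add: matrix_vector_mul_assoc orth_proj_idem)

lemma orth_proj_psd: "orth_proj V \<Longrightarrow> psd_mat V"
  using psd_mat_congruence[OF psd_mat_mat_1, of V] by (simp add: orth_proj_def hermitian_mat_def)

lemma orth_proj_zero: "orth_proj 0"
  and orth_proj_mat_1: "orth_proj (mat 1)"
  by (simp_all add: orth_proj_def hermitian_mat_simps matrix_mult_simps)

lemma orth_proj_diff:
  assumes "orth_proj V" "orth_proj W" "W ** V = W"
  shows "orth_proj (V - W)"
proof -
  have "V ** W = W"
    using assms hermitian_support_left orth_proj_hermitian by blast
  thus ?thesis using assms
    by (simp add: orth_proj_def hermitian_mat_simps matrix_mult_simps)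
qed

text \<open>Shows that \<open>outer (x + y)\<close> is dominated by twice
  \<open>outer x + outer y\<close>. This later makes the vectors whose outer product is annihilated
  by a positive map closed under addition.\<close>

lemma outer_parallelogram: "outer (x + y) + outer (x - y) = 2 *\<^sub>R (outer x + outer y)"
  by (simp add: outer_def vec_eq_iff algebra_simps scaleR_2)

lemma outer_smult: "outer (c *s x) = mat (c * cnj c) ** outer x"
  by (simp add: outer_def vec_eq_iff mat_mult_entry)

lemma outer_zero: "outer 0 = 0"
  by (simp add: outer_def vec_eq_iff)

lemma mult_adj_mat_eq_sum_outer:
  fixes A :: "'k::finite cmat"
  shows "A ** adj_mat A = (\<Sum>i\<in>UNIV. outer (A *v axis i 1))"
  by (simp add: vec_eq_iff outer_def matrix_vector_axis matrix_matrix_mult_def adj_mat_def)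

lemma orth_proj_eq_sum_outer:
  "orth_proj V \<Longrightarrow> V = (\<Sum>i\<in>UNIV. outer (V *v axis i 1))"
  using mult_adj_mat_eq_sum_outer[of V] by (simp add: orth_proj_def hermitian_mat_def)

lemma matrix_eq_zero_axis:
  fixes A :: "'k::finite cmat"
  assumes "\<And>i. A *v axis i 1 = 0"
  shows "A = 0"
  using assms by (metis matrix_vector_axis vec_eq_iff zero_index)

text \<open>\<open>W\<close> is the sum of the outer products of its columns, so the trace is a sum
  of nonnegative values of the form of \<open>A\<close>. Each of them vanishes, which puts every
  column of \<open>W\<close> into the kernel of \<open>A\<close>.\<close>

lemma psd_mat_mult_eq_zeroI:
  assumes "psd_mat A" "orth_proj W" "trace (A ** W) = 0"
  shows "A ** W = 0"
proof (rule matrix_eq_zero_axis)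
  fix i
  have "0 = trace (A ** (\<Sum>i\<in>UNIV. outer (W *v axis i 1)))"
    using assms orth_proj_eq_sum_outer by metis
  also have "\<dots> = (\<Sum>i\<in>UNIV. quad_form A (W *v axis i 1))"
    by (simp add: matrix_mult_sum_right trace_def sum_component flip: trace_mult_outer) (rule sum.swap)
  finally have "(\<Sum>i\<in>UNIV. Re (quad_form A (W *v axis i 1))) = 0"
    by (metis Re_sum zero_complex.simps(1))
  hence "Re (quad_form A (W *v axis i 1)) = 0"
    using assms(1) by (subst (asm) sum_nonneg_eq_0_iff) (auto simp: psd_mat_def)
  thus "A ** W *v axis i 1 = 0"
    using psd_mat_kernel[OF assms(1), of "W *v axis i 1"] by (simp add: matrix_vector_mul_assoc)
qed

section \<open>Ranges of projections and their dimension\<close>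

lemma subspace_range_proj: "vec.subspace {x. (V :: 'k::finite cmat) *v x = x}"
  by (rule vec.subspaceI) (simp_all add: algebra_simps vec.scale)

lemma dim_range_proj_less:
  fixes V W :: "'k::finite cmat"
  assumes "\<And>x. W *v x = x \<Longrightarrow> V *v x = x" "V *v y = y" "W *v y \<noteq> y"
  shows "vec.dim {x. W *v x = x} < vec.dim {x. V *v x = x}"
proof (rule vec.dim_psubset)
  have "{x. W *v x = x} \<subset> {x. V *v x = x}" using assms by blast
  thus "vec.span {x. W *v x = x} \<subset> vec.span {x. V *v x = x}"
    by (simp only: vec.span_eq_iff[THEN iffD2, OF subspace_range_proj])
qed

text \<open>Provides the decreasing measure for the recursive splitting of projections.\<close>

lemma dim_range_orth_proj_less:
  assumes "orth_proj V" "orth_proj W" "W ** V = W" "W \<noteq> V"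
  shows "vec.dim {x. W *v x = x} < vec.dim {x. V *v x = x}"
proof -
  have VW: "V ** W = W" using assms hermitian_support_left orth_proj_hermitian by blast
  obtain y where y: "V *v y \<noteq> W *v y" using assms(4) by (metis matrix_eq)
  show ?thesis
  proof (rule dim_range_proj_less)
    show "V *v x = x" if "W *v x = x" for x
      by (metis VW that matrix_vector_mul_assoc)
    show "V *v (V *v y) = V *v y" by (simp add: assms orth_proj_idem_vec)
    show "W *v (V *v y) \<noteq> V *v y" using y by (simp add: matrix_vector_mul_assoc assms)
  qed
qed

text \<open>An extremal argument instead of Gram-Schmidt: among the orthogonal projections with
  values in S, one whose range has the largest dimension must fix all of S.\<close>

lemma ex_orth_proj_onto:
  fixes S :: "(complex^'k::finite) set"
  assumes S: "vec.subspace S"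
  shows "\<exists>P. orth_proj P \<and> (\<forall>x. P *v x \<in> S) \<and> (\<forall>x\<in>S. P *v x = x)"
proof -
  define good where "good = (\<lambda>P :: 'k cmat. orth_proj P \<and> (\<forall>x. P *v x \<in> S))"
  have "good 0" using S by (simp add: good_def orth_proj_zero vec.subspace_0)
  moreover have "\<forall>P. good P \<longrightarrow> vec.dim {x. P *v x = x} < CARD('k) + 1"
    by (metis vec.dim_subset_UNIV less_Suc_eq_le Suc_eq_plus1 vec_dim_card vec.dim_UNIV vec.dimension_def)
  ultimately obtain P where P: "good P"
    and max: "\<And>P'. good P' \<Longrightarrow> vec.dim {x. P' *v x = x} \<le> vec.dim {x. P *v x = x}"
    using ex_has_greatest_nat[of good 0 "\<lambda>P. vec.dim {x. P *v x = x}"] by blast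
  have PP: "P ** P = P" and hP: "hermitian_mat P" and PS: "\<And>x. P *v x \<in> S"
    using P by (auto simp: good_def orth_proj_def)
  have "P *v x = x" if "x \<in> S" for x
  proof (rule ccontr)
    assume neq: "P *v x \<noteq> x"
    define w where "w = x - P *v x"
    \<comment> \<open>The second summand projects onto the line of \<open>w\<close>, which lies in
      \<open>S\<close> and is orthogonal to the range of \<open>P\<close>. So \<open>P'\<close> has
      a larger range inside \<open>S\<close>.\<close>
    define P' where "P' = P + (1 / (norm w)\<^sup>2) *\<^sub>R outer w"
    have w0: "w \<noteq> 0" using neq by (simp add: w_def)
    have wS: "w \<in> S" using S that PS by (simp add: w_def vec.subspace_diff)
    have Pw: "P *v w = 0" by (simp add: w_def algebra_simps matrix_vector_mul_assoc PP)
    have P'v: "P' *v z = P *v z + (cip w z / of_real ((norm w)\<^sup>2)) *s w" for z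
    proof -
      have "((1 / (norm w)\<^sup>2) *\<^sub>R outer w) *v z = (cip w z / of_real ((norm w)\<^sup>2)) *s w"
        by (simp add: vec_eq_iff matrix_vector_mult_def outer_def cip_def sum_distrib_left
            sum_distrib_right sum_divide_distrib)
           (simp add: scaleR_conv_of_real mult_ac)
      thus ?thesis by (simp add: P'_def algebra_simps)
    qed
    have cwP: "cip w (P *v z) = 0" for z
      by (metis Pw cip_hermitian cip_zero_left hP)
    have "hermitian_mat P'" unfolding P'_def using hP by (intro hermitian_mat_simps)
    moreover have "P' *v (P' *v z) = P' *v z" for z
      using w0 orth_proj_idem_vec[of P] P
      by (simp add: P'v algebra_simps vec.scale cip_simps cwP Pw cip_self good_def)
    hence "P' ** P' = P'" by (simp add: matrix_eq flip: matrix_vector_mul_assoc)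
    moreover have "P' *v z \<in> S" for z
      using S wS PS by (simp add: P'v vec.subspace_add vec.subspace_scale)
    ultimately have "good P'" by (simp add: good_def orth_proj_def)
    moreover have "vec.dim {x. P *v x = x} < vec.dim {x. P' *v x = x}"
    proof (rule dim_range_proj_less)
      show "P' *v z = z" if "P *v z = z" for z
        using cwP[of z] that by (simp add: P'v)
      show "P' *v w = w" using w0 by (simp add: P'v Pw cip_self)
      show "P *v w \<noteq> w" using w0 Pw by simp
    qed
    ultimately show False using max[of P'] by linarith
  qed
  moreover have "orth_proj P" using P by (simp add: good_def)
  ultimately show ?thesis using PS by blast
qed

section \<open>Corners of the matrix algebra\<close>

lemma mem_corner_iff:
  assumes "orth_proj V"
  shows "Y \<in> corner V V \<longleftrightarrow> V ** Y = Y \<and> Y ** V = Y"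
proof
  assume "Y \<in> corner V V"
  then obtain X where "Y = V ** X ** V" by (auto simp: corner_def)
  moreover have "V ** (V ** X ** V) = (V ** V) ** X ** V" by (simp add: matrix_mul_assoc)
  moreover have "(V ** X ** V) ** V = V ** X ** (V ** V)" by (simp add: matrix_mul_assoc)
  ultimately show "V ** Y = Y \<and> Y ** V = Y" by (simp add: orth_proj_idem[OF assms])
next
  assume "V ** Y = Y \<and> Y ** V = Y"
  thus "Y \<in> corner V V" unfolding corner_def by (auto intro!: exI[of _ Y])
qed

lemma corner_subset_iff:
  assumes V: "orth_proj V" and W: "orth_proj W"
  shows "corner W W \<subseteq> corner V V \<longleftrightarrow> W ** V = W"
proof
  assume "corner W W \<subseteq> corner V V"
  moreover have "W \<in> corner W W" using W by (simp add: mem_corner_iff orth_proj_idem)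
  ultimately show "W ** V = W" using V mem_corner_iff by blast
next
  assume WV: "W ** V = W"
  hence VW: "V ** W = W" using V W hermitian_support_left orth_proj_hermitian by blast
  show "corner W W \<subseteq> corner V V"
  proof
    fix Y assume "Y \<in> corner W W"
    hence "Y = W ** Y" "Y = Y ** W" using W by (simp_all add: mem_corner_iff)
    hence "V ** Y = Y" "Y ** V = Y"
      by (metis VW matrix_mul_assoc, metis WV matrix_mul_assoc)
    thus "Y \<in> corner V V" using V by (simp add: mem_corner_iff)
  qed
qed

text \<open>Compression by \<open>W\<close> is self-adjoint by cyclicity of the trace. This links
  orthogonality to the corner of \<open>W\<close> with the vanishing of
  \<open>W ** Z ** W\<close>.\<close>

lemma tr_inner_corner:
  assumes "hermitian_mat W"
  shows "tr_inner Z (W ** K ** W) = trace ((W ** Z ** W) ** adj_mat K)"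
proof -
  have "tr_inner Z (W ** K ** W) = trace ((Z ** W ** adj_mat K) ** W)"
    using assms by (simp add: tr_inner_def adj_mat_mult hermitian_mat_def matrix_mul_assoc)
  also have "\<dots> = trace (W ** (Z ** W ** adj_mat K))" by (rule trace_mul_sym)
  finally show ?thesis by (simp add: matrix_mul_assoc)
qed

lemma hermitian_mat_bounded:
  fixes H :: "'k::finite cmat"
  assumes "hermitian_mat H"
  obtains c where "c \<ge> 0" "psd_mat (c *\<^sub>R mat 1 + H)" "psd_mat (c *\<^sub>R mat 1 - H)"
proof -
  \<comment> \<open>The sum of the moduli of all entries is a crude bound for the form on unit
    vectors.\<close>
  define c where "c = (\<Sum>i\<in>UNIV. \<Sum>j\<in>UNIV. norm (H $ i $ j))"
  have bound: "norm (quad_form H x) \<le> c * (norm x)\<^sup>2" for x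
  proof -
    have "quad_form H x = (\<Sum>i\<in>UNIV. \<Sum>j\<in>UNIV. cnj (x $ i) * (H $ i $ j * x $ j))"
      by (simp add: quad_form_def matrix_vector_mult_def sum_distrib_left)
    also have "norm \<dots> \<le> (\<Sum>i\<in>UNIV. \<Sum>j\<in>UNIV. norm (H $ i $ j) * (norm x)\<^sup>2)"
    proof (intro sum_norm_le)
      fix i j
      have "norm (cnj (x $ i) * (H $ i $ j * x $ j)) = norm (H $ i $ j) * (norm (x $ i) * norm (x $ j))"
        by (simp add: norm_mult)
      also have "\<dots> \<le> norm (H $ i $ j) * (norm x)\<^sup>2"
        unfolding power2_eq_square
        by (intro mult_left_mono mult_mono Finite_Cartesian_Product.norm_nth_le) auto
      finally show "norm (cnj (x $ i) * (H $ i $ j * x $ j)) \<le> norm (H $ i $ j) * (norm x)\<^sup>2" .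
    qed
    also have "\<dots> = c * (norm x)\<^sup>2" by (simp add: c_def sum_distrib_right)
    finally show ?thesis .
  qed
  have b: "\<bar>Re (quad_form H x)\<bar> \<le> c * (norm x)\<^sup>2" for x
    using bound[of x] abs_Re_le_cmod order_trans by blast
  have "c \<ge> 0" by (simp add: c_def sum_nonneg)
  moreover have "psd_mat (c *\<^sub>R mat 1 + H)"
    unfolding psd_mat_def
  proof (intro conjI allI)
    show "0 \<le> Re (quad_form (c *\<^sub>R mat 1 + H) x)" for x
      using b[of x] by (simp add: quad_form_simps)
  qed (intro hermitian_mat_simps assms)
  moreover have "psd_mat (c *\<^sub>R mat 1 - H)"
    unfolding psd_mat_def
  proof (intro conjI allI)
    show "0 \<le> Re (quad_form (c *\<^sub>R mat 1 - H) x)" for x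
      using b[of x] by (simp add: quad_form_simps)
  qed (intro hermitian_mat_simps assms)
  ultimately show ?thesis using that by blast
qed

lemma cartesian_decomposition:
  fixes X :: "'k::finite cmat"
  obtains H K where "hermitian_mat H" "hermitian_mat K" "X = H + mat \<i> ** K"
proof
  let ?H = "(1/2) *\<^sub>R (X + adj_mat X)" and ?K = "mat (- \<i> / 2) ** (X - adj_mat X)"
  show "hermitian_mat ?H" by (simp add: hermitian_mat_def adj_mat_simps add.commute)
  show "hermitian_mat ?K"
    by (simp add: hermitian_mat_def vec_eq_iff mat_mult_entry adj_mat_def field_simps)
  show "X = ?H + mat \<i> ** ?K"
    by (simp add: vec_eq_iff mat_mult_entry adj_mat_def) (simp add: scaleR_conv_of_real field_simps)
qed

section \<open>Completely reducible maps\<close>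

text \<open>Complex homogeneity is expressed through the scalar matrix \<open>mat c\<close>, since
  \<open>*\<^sub>R\<close> covers real scalars only.\<close>

locale linear_positive_map =
  fixes T :: "'k::finite cmat \<Rightarrow> 'k cmat"
  assumes map_add: "T (X + Y) = T X + T Y"
    and map_smult: "T (mat c ** X) = mat c ** T X"
    and positive: "positive_map T"
begin

section \<open>Supports of images under a positive map\<close>

lemma map_psd: "psd_mat X \<Longrightarrow> psd_mat (T X)"
  using positive by (simp add: positive_map_def)

lemma map_scaleR: "T (r *\<^sub>R X) = r *\<^sub>R T X"
  by (metis map_smult mat_scaleR)

lemma map_zero: "T 0 = 0"
  using map_add[of 0 0] by simp

lemma map_diff: "T (X - Y) = T X - T Y"
  using map_add[of "X - Y" Y] by simp

lemma map_sum: "T (\<Sum>i\<in>I. f i) = (\<Sum>i\<in>I. T (f i))"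
  by (induction I rule: infinite_finite_induct) (simp_all add: map_zero map_add)

lemma map_support_mono:
  assumes "psd_mat A" "psd_mat (B - A)" "T B ** U = T B"
  shows "T A ** U = T A"
proof (rule psd_mat_le_support)
  show "psd_mat (T B - T A)" using map_psd[OF assms(2)] by (simp add: map_diff)
qed (use assms map_psd in auto)

text \<open>A sandwich argument: A = V (c + H) V satisfies 0 \<le> A \<le> 2 c V, so
  \<open>T A\<close> inherits the support of \<open>T V\<close>. Subtracting
  \<open>T (c *\<^sub>R V)\<close> leaves the image of V H V.\<close>

lemma map_support_corner_hermitian:
  assumes V: "orth_proj V" and TV: "T V ** U = T V" and U: "hermitian_mat U" and H: "hermitian_mat H"
  shows "T (V ** H ** V) ** U = T (V ** H ** V) \<and> U ** T (V ** H ** V) = T (V ** H ** V)"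
proof -
  obtain c where c: "c \<ge> 0" "psd_mat (c *\<^sub>R mat 1 + H)" "psd_mat (c *\<^sub>R mat 1 - H)"
    using hermitian_mat_bounded[OF H] by blast
  have hV: "adj_mat V = V" and VV: "V ** V = V"
    using V by (auto simp: orth_proj_def hermitian_mat_def)
  have cV: "V ** (c *\<^sub>R mat 1) ** V = c *\<^sub>R V"
    by (metis VV mat_scaleR mat_commute matrix_mul_assoc matrix_mul_rid)
  define A where "A = V ** (c *\<^sub>R mat 1 + H) ** V"
  have A_eq: "A = c *\<^sub>R V + V ** H ** V" by (simp add: A_def matrix_mult_simps cV)
  have A: "psd_mat A" using psd_mat_congruence[OF c(2), of V] by (simp add: A_def hV)
  have "(2 * c) *\<^sub>R V - A = V ** (c *\<^sub>R mat 1 - H) ** V"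
    by (simp only: A_eq matrix_mult_simps cV mult_2 scaleR_left_distrib) simp
  hence "psd_mat ((2 * c) *\<^sub>R V - A)" using psd_mat_congruence[OF c(3), of V] by (simp add: hV)
  moreover have TcV: "T (r *\<^sub>R V) ** U = T (r *\<^sub>R V)" for r
    by (metis TV map_scaleR mat_scaleR matrix_mul_assoc)
  ultimately have TA: "T A ** U = T A" using map_support_mono A by blast
  have UTA: "U ** T A = T A"
    using TA U A map_psd psd_mat_hermitian hermitian_support_left by blast
  have "hermitian_mat (T (c *\<^sub>R V))"
    using V by (simp add: map_scaleR hermitian_mat_simps psd_mat_hermitian map_psd orth_proj_psd)
  hence UTV: "U ** T (c *\<^sub>R V) = T (c *\<^sub>R V)"
    using TcV U hermitian_support_left by blast
  have "T (V ** H ** V) = T A - T (c *\<^sub>R V)" by (simp add: A_eq map_add)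
  thus ?thesis by (simp add: matrix_mult_simps TA UTA TcV UTV)
qed

lemma map_support_corner:
  assumes V: "orth_proj V" and TV: "T V ** U = T V" and U: "hermitian_mat U"
  shows "T (V ** X ** V) ** U = T (V ** X ** V)" "U ** T (V ** X ** V) = T (V ** X ** V)"
proof -
  obtain H K where HK: "hermitian_mat H" "hermitian_mat K" "X = H + mat \<i> ** K"
    using cartesian_decomposition by blast
  have "V ** X ** V = V ** H ** V + V ** mat \<i> ** K ** V"
    by (simp add: HK matrix_mult_simps matrix_mul_assoc)
  also have "V ** mat \<i> ** K ** V = mat \<i> ** (V ** K ** V)"
    by (simp add: mat_commute matrix_mul_assoc)
  finally have eq: "T (V ** X ** V) = T (V ** H ** V) + mat \<i> ** T (V ** K ** V)"
    by (simp add: map_add map_smult)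
  note H = map_support_corner_hermitian[OF V TV U HK(1)]
  note K = map_support_corner_hermitian[OF V TV U HK(2)]
  have "(mat \<i> ** T (V ** K ** V)) ** U = mat \<i> ** T (V ** K ** V)"
    using K by (metis matrix_mul_assoc)
  moreover have "U ** (mat \<i> ** T (V ** K ** V)) = mat \<i> ** T (V ** K ** V)"
    using K by (metis matrix_mul_assoc mat_commute)
  ultimately show "T (V ** X ** V) ** U = T (V ** X ** V)" "U ** T (V ** X ** V) = T (V ** X ** V)"
    using H by (simp_all add: eq matrix_mult_simps)
qed

text \<open>Testing on \<open>V\<close> alone suffices, because by \<open>map_support_corner\<close>
  the support of \<open>T V\<close> controls the images of the whole corner.\<close>

lemma corner_invariant_iff:
  assumes "orth_proj V"
  shows "T ` corner V V \<subseteq> corner V V \<longleftrightarrow> T V ** V = T V"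
proof
  assume "T ` corner V V \<subseteq> corner V V"
  moreover have "V \<in> corner V V" using assms by (simp add: mem_corner_iff orth_proj_idem)
  ultimately show "T V ** V = T V" using assms mem_corner_iff by blast
next
  assume "T V ** V = T V"
  hence "T (V ** X ** V) \<in> corner V V" for X
    using map_support_corner[OF assms] orth_proj_hermitian[OF assms] mem_corner_iff[OF assms] by metis
  thus "T ` corner V V \<subseteq> corner V V" by (auto simp: corner_def)
qed

lemma irreducible_on_iff:
  assumes "orth_proj V"
  shows "irreducible_on T V \<longleftrightarrow>
    (\<forall>W. orth_proj W \<longrightarrow> W ** V = W \<longrightarrow> T W ** W = T W \<longrightarrow> W = 0 \<or> W = V)"
  unfolding irreducible_on_def using corner_invariant_iff corner_subset_iff[OF assms] by blast

lemma map_psd_sum_eq_zero: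
  assumes "T (\<Sum>i\<in>I. f i) = 0" "finite I" "i \<in> I" "\<And>i. i \<in> I \<Longrightarrow> psd_mat (f i)"
  shows "T (f i) = 0"
proof -
  \<comment> \<open>Support in the zero projection means being zero, and each summand is dominated
    by the full sum.\<close>
  have "T (f i) ** 0 = T (f i)"
  proof (rule map_support_mono)
    have "(\<Sum>i\<in>I. f i) - f i = (\<Sum>i\<in>I - {i}. f i)" using assms by (simp add: sum_diff1)
    thus "psd_mat ((\<Sum>i\<in>I. f i) - f i)" using assms(4) psd_mat_sum[of "I - {i}" f] by simp
  qed (use assms in \<open>auto simp: matrix_mult_simps\<close>)
  thus ?thesis by (simp add: matrix_mult_simps)
qed

text \<open>Closure under addition comes from the parallelogram identity: the image of
  \<open>outer (x + y)\<close> is dominated by a matrix that is zero.\<close>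

lemma subspace_map_outer_eq_zero: "vec.subspace {x. W *v x = x \<and> T (outer x) = 0}"
proof (rule vec.subspaceI)
  fix x y assume "x \<in> {x. W *v x = x \<and> T (outer x) = 0}" "y \<in> {x. W *v x = x \<and> T (outer x) = 0}"
  hence x: "W *v x = x" "T (outer x) = 0" and y: "W *v y = y" "T (outer y) = 0" by auto
  have "T (outer (x + y)) ** 0 = T (outer (x + y))"
  proof (rule map_support_mono[OF psd_mat_outer])
    let ?B = "2 *\<^sub>R (outer x + outer y)"
    have "?B - outer (x + y) = outer (x - y)" using outer_parallelogram[of x y] by (simp add: algebra_simps)
    thus "psd_mat (?B - outer (x + y))" by (simp add: psd_mat_outer)
    show "T ?B ** 0 = T ?B" unfolding map_scaleR map_add x y by (simp add: matrix_mult_simps)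
  qed
  thus "x + y \<in> {x. W *v x = x \<and> T (outer x) = 0}"
    using x y by (simp add: matrix_mult_simps algebra_simps)
qed (simp_all add: outer_zero map_zero outer_smult map_smult vec.scale matrix_mult_simps)

end

text \<open>Only the block V M (1 - V) is named. The opposite block is reached by applying the
  condition to a complementary invariant projection, as in
  \<open>splits_corners_decomposition\<close>.\<close>

definition splits_corners :: "('k::finite cmat \<Rightarrow> 'k cmat) \<Rightarrow> bool" where
  "splits_corners T \<longleftrightarrow>
    (\<forall>V. orth_proj V \<longrightarrow> T V ** V = T V \<longrightarrow> (\<forall>X. T (V ** X ** (mat 1 - V)) = 0))"

section \<open>Complete reducibility and the splitting of invariant corners\<close>

context linear_positive_map
begin

text \<open>Irreducibility is used twice inside \<open>W\<close>: for the projection onto the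
  intersection of the ranges of \<open>V\<close> and \<open>W\<close>, and, if that is zero, for the
  projection onto the vectors of the range of \<open>W\<close> whose outer product is annihilated by
  \<open>T\<close>.\<close>

lemma invariant_orth_proj_trichotomy:
  assumes V: "orth_proj V" and W: "orth_proj W" and TW: "T W ** W = T W"
    and irr: "irreducible_on T W" and TV: "T V ** V = T V"
    and TWVW: "T (W ** V ** W) ** V = T (W ** V ** W)"
  shows "W ** V = W \<or> W ** V = 0 \<or> T W = 0"
proof -
  note irr = irr[unfolded irreducible_on_iff[OF W], rule_format]
  note h = orth_proj_hermitian
  have "vec.subspace {x. W *v x = x \<and> V *v x = x}"
    by (rule vec.subspaceI) (simp_all add: algebra_simps vec.scale)
  from ex_orth_proj_onto[OF this] obtain Q where Q: "orth_proj Q"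
    and QS: "\<forall>x. Q *v x \<in> {x. W *v x = x \<and> V *v x = x}"
    and QE: "\<forall>x\<in>{x. W *v x = x \<and> V *v x = x}. Q *v x = x" by blast
  have WQ: "W ** Q = Q" and VQ: "V ** Q = Q"
    using QS by (simp_all add: matrix_eq flip: matrix_vector_mul_assoc)
  have QW: "Q ** W = Q" and QV: "Q ** V = Q"
    using WQ VQ h[OF Q] h[OF V] h[OF W] by (metis adj_mat_mult hermitian_mat_def)+
  \<comment> \<open>A positive matrix supported in both \<open>V\<close> and \<open>W\<close> has
    its range in the intersection, which \<open>Q\<close> fixes.\<close>
  have Q_fix: "Q ** M = M" if "psd_mat M" "M ** W = M" "M ** V = M" for M
  proof -
    have "W ** M = M" "V ** M = M"
      using that h[OF V] h[OF W] psd_mat_hermitian hermitian_support_left by blast+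
    hence "W *v (M *v x) = M *v x" "V *v (M *v x) = M *v x" for x
      by (simp_all add: matrix_vector_mul_assoc)
    thus ?thesis using QE by (simp add: matrix_eq flip: matrix_vector_mul_assoc)
  qed
  have TQ: "psd_mat (T Q)" using Q by (simp add: map_psd orth_proj_psd)
  have "T Q ** W = T Q" "T Q ** V = T Q"
    using map_support_mono[OF orth_proj_psd[OF Q] orth_proj_psd[OF orth_proj_diff[OF W Q QW]] TW]
      map_support_mono[OF orth_proj_psd[OF Q] orth_proj_psd[OF orth_proj_diff[OF V Q QV]] TV]
    by auto
  hence "Q ** T Q = T Q" using Q_fix TQ by blast
  hence "T Q ** Q = T Q"
    using h[OF Q] psd_mat_hermitian[OF TQ] by (metis adj_mat_mult hermitian_mat_def)
  hence "Q = 0 \<or> Q = W" using irr Q QW by blast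
  moreover have ?thesis if "Q = W" using that QV by blast
  moreover have ?thesis if Q0: "Q = 0"
  proof -
    have adjs: "adj_mat W = W" "adj_mat V = V" using h V W by (auto simp: hermitian_mat_def)
    \<comment> \<open>As \<open>V\<close> is a projection, this compression is K K^* with K = W V,
      so it is a sum of outer products of the columns of K.\<close>
    have WVW: "W ** V ** W = (\<Sum>i\<in>UNIV. outer (W ** V *v axis i 1))"
    proof -
      have "W ** V ** adj_mat (W ** V) = W ** (V ** V) ** W"
        by (simp add: adj_mat_mult adjs matrix_mul_assoc)
      thus ?thesis using mult_adj_mat_eq_sum_outer[of "W ** V"] V by (simp add: orth_proj_idem)
    qed
    have psd: "psd_mat (T (W ** V ** W))"
      unfolding WVW by (intro map_psd psd_mat_sum psd_mat_outer)
    have "T (W ** V ** W) ** W = T (W ** V ** W)"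
      using map_support_corner(1)[OF W TW h[OF W]] .
    hence "T (W ** V ** W) = 0"
      using Q_fix[OF psd _ TWVW] by (simp add: Q0 matrix_mult_simps)
    hence T0: "T (outer (W ** V *v axis i 1)) = 0" for i
      unfolding WVW by (rule map_psd_sum_eq_zero) (auto simp: psd_mat_outer)
    from ex_orth_proj_onto[OF subspace_map_outer_eq_zero] obtain P where P: "orth_proj P"
      and PS: "\<forall>x. P *v x \<in> {x. W *v x = x \<and> T (outer x) = 0}"
      and PE: "\<forall>x\<in>{x. W *v x = x \<and> T (outer x) = 0}. P *v x = x" by blast
    have "W ** P = P" using PS by (simp add: matrix_eq flip: matrix_vector_mul_assoc)
    hence PW: "P ** W = P" using h[OF P] h[OF W] by (metis adj_mat_mult hermitian_mat_def)
    have "T P = (\<Sum>i\<in>UNIV. T (outer (P *v axis i 1)))"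
      using orth_proj_eq_sum_outer[OF P] map_sum by metis
    hence TP: "T P = 0" using PS by simp
    \<comment> \<open>With \<open>T P = 0\<close> the invariance condition for \<open>P\<close> is
      trivially satisfied.\<close>
    hence "P = 0 \<or> P = W" using irr P PW by (simp add: matrix_mult_simps)
    moreover have "W ** V = 0" if "P = 0"
    proof (rule matrix_eq_zero_axis)
      fix i
      have "W *v (W ** V *v axis i 1) = W ** V *v axis i 1"
        by (simp add: matrix_vector_mul_assoc matrix_mul_assoc orth_proj_idem[OF W])
      hence "P *v (W ** V *v axis i 1) = W ** V *v axis i 1" using PE T0 by blast
      thus "W ** V *v axis i 1 = 0" by (simp add: that)
    qed
    ultimately show ?thesis using TP by blast
  qed
  ultimately show ?thesis by blast
qed

text \<open>\<open>T\<close> only sees the diagonal blocks, so V X (1 - V) need only be compressed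
  to each \<open>W i\<close>. In each case of the trichotomy the compression or its image
  vanishes.\<close>

lemma completely_reducible_imp_splits_corners:
  assumes "completely_reducible T"
  shows "splits_corners T"
proof -
  obtain Ws :: "'k cmat list" where Ws:
    "\<forall>i<length Ws. orth_proj (Ws ! i)"
    "\<forall>i<length Ws. \<forall>j<length Ws. i \<noteq> j \<longrightarrow> Ws ! i ** Ws ! j = 0"
    "\<forall>i<length Ws. T ` corner (Ws ! i) (Ws ! i) \<subseteq> corner (Ws ! i) (Ws ! i) \<and> irreducible_on T (Ws ! i)"
    "\<forall>X. (\<forall>i<length Ws. \<forall>Y\<in>corner (Ws ! i) (Ws ! i). tr_inner X Y = 0) \<longrightarrow> T X = 0"
    using assms unfolding completely_reducible_def by blast
  define n where "n = length Ws"
  define W where "W = (\<lambda>i. Ws ! i)"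
  have W: "orth_proj (W i)" if "i < n" for i using Ws(1) that by (simp add: W_def n_def)
  have orth: "W i ** W j = 0" if "i < n" "j < n" "i \<noteq> j" for i j
    using Ws(2) that by (simp add: W_def n_def)
  have irr: "irreducible_on T (W i)" if "i < n" for i using Ws(3) that by (simp add: W_def n_def)
  have TW: "T (W i) ** W i = T (W i)" if "i < n" for i
    using Ws(3) that corner_invariant_iff[OF W[OF that]] by (simp add: W_def n_def)
  have decomp: "T X = (\<Sum>i<n. T (W i ** X ** W i))" for X
  proof -
    \<comment> \<open>Removing the diagonal blocks leaves a matrix orthogonal to all corners, on
      which \<open>T\<close> vanishes.\<close>
    define Z where "Z = X - (\<Sum>i<n. W i ** X ** W i)"
    have Z0: "W j ** Z ** W j = 0" if j: "j < n" for j
    proof -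
      have "W j ** (\<Sum>i<n. W i ** X ** W i) ** W j = (\<Sum>i<n. (W j ** W i) ** X ** (W i ** W j))"
        by (simp add: matrix_mult_sum_left matrix_mult_sum_right matrix_mul_assoc)
      also have "\<dots> = (\<Sum>i<n. if i = j then W j ** X ** W j else 0)"
        using j orth by (intro sum.cong) (auto simp: matrix_mult_simps orth_proj_idem W)
      also have "\<dots> = W j ** X ** W j" using j by simp
      finally show ?thesis by (simp add: Z_def matrix_mult_simps)
    qed
    have "tr_inner Z Y = 0" if "i < n" "Y \<in> corner (W i) (W i)" for i Y
      using that tr_inner_corner[OF orth_proj_hermitian[OF W[OF that(1)]]] Z0
      by (auto simp: corner_def matrix_mult_simps trace_zero)
    hence "T Z = 0" using Ws(4) by (simp add: W_def n_def)
    thus ?thesis by (simp add: Z_def map_diff map_sum)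
  qed
  show ?thesis
    unfolding splits_corners_def
  proof (intro allI impI)
    fix V X
    assume V: "orth_proj V" and TV: "T V ** V = T V"
    have "T (W i ** (V ** X ** (mat 1 - V)) ** W i) = 0" if i: "i < n" for i
    proof -
      have psd: "psd_mat (T (W j ** V ** W j))" if "j < n" for j
        using psd_mat_congruence[OF orth_proj_psd[OF V], of "W j"] W[OF that]
        by (simp add: map_psd orth_proj_def hermitian_mat_def)
      \<comment> \<open>\<open>T V\<close> is the sum of the positive matrices
        \<open>T (W j ** V ** W j)\<close>, so each of them is dominated by \<open>T V\<close> and
        inherits its support.\<close>
      have "T (W i ** V ** W i) ** V = T (W i ** V ** W i)"
      proof (rule psd_mat_le_support[OF psd[OF i] _ TV])
        have "T V - T (W i ** V ** W i) = (\<Sum>j\<in>{..<n} - {i}. T (W j ** V ** W j))"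
          using i by (subst decomp) (simp add: sum_diff1)
        thus "psd_mat (T V - T (W i ** V ** W i))"
          using psd psd_mat_sum[of "{..<n} - {i}" "\<lambda>j. T (W j ** V ** W j)"] by simp
      qed
      from invariant_orth_proj_trichotomy[OF V W[OF i] TW[OF i] irr[OF i] TV this]
      consider "W i ** V = W i" | "W i ** V = 0" | "T (W i) = 0" by blast
      thus ?thesis
      proof cases
        case 1
        hence "V ** W i = W i"
          using V W[OF i] hermitian_support_left orth_proj_hermitian by blast
        hence "(mat 1 - V) ** W i = 0" by (simp add: matrix_mult_simps)
        hence "W i ** (V ** X ** (mat 1 - V)) ** W i = 0"
          by (metis matrix_mul_assoc matrix_mult_zero_right)
        thus ?thesis by (simp add: map_zero)
      next
        case 2
        hence "W i ** (V ** X ** (mat 1 - V)) ** W i = 0"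
          by (metis matrix_mul_assoc matrix_mult_zero_left)
        thus ?thesis by (simp add: map_zero)
      next
        case 3
        \<comment> \<open>Taking the zero matrix as support, \<open>map_support_corner\<close> shows
          that \<open>T\<close> vanishes on the whole corner of \<open>W i\<close>.\<close>
        thus ?thesis
          using map_support_corner(1)[OF W[OF i] _ hermitian_mat_zero]
          by (metis matrix_mult_zero_right)
      qed
    qed
    thus "T (V ** X ** (mat 1 - V)) = 0" by (subst decomp) simp
  qed
qed

text \<open>Self-adjointness turns the trace of T(V - W) against W into the pairing of V - W with T
  W, which is zero because T W is supported in W. For positive matrices a vanishing trace means a
  vanishing product.\<close>

lemma invariant_complement:
  assumes sa: "self_adjoint_map T" and V: "orth_proj V" and TV: "T V ** V = T V"
    and W: "orth_proj W" and WV: "W ** V = W" and TW: "T W ** W = T W"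
  shows "T (V - W) ** (V - W) = T (V - W)"
proof -
  have VW: "V ** W = W" using V W WV hermitian_support_left orth_proj_hermitian by blast
  have U: "orth_proj (V - W)" using orth_proj_diff V W WV by blast
  have TU: "psd_mat (T (V - W))" by (intro map_psd orth_proj_psd U)
  have "psd_mat (V - (V - W))" using W by (simp add: orth_proj_psd)
  hence TUV: "T (V - W) ** V = T (V - W)"
    using map_support_mono[OF orth_proj_psd[OF U] _ TV] by blast
  have hTW: "hermitian_mat (T W)" by (intro psd_mat_hermitian map_psd orth_proj_psd W)
  have WTW: "W ** T W = T W" using hTW TW W hermitian_support_left orth_proj_hermitian by blast
  have "trace (T (V - W) ** W) = tr_inner (T (V - W)) W"
    using W by (simp add: tr_inner_def orth_proj_def hermitian_mat_def)
  also have "\<dots> = tr_inner (V - W) (T W)" using sa by (simp add: self_adjoint_map_def)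
  also have "\<dots> = trace ((V - W) ** (W ** T W))"
    using hTW WTW by (simp add: tr_inner_def hermitian_mat_def)
  also have "(V - W) ** (W ** T W) = 0"
    by (simp add: matrix_mul_assoc matrix_mult_simps VW orth_proj_idem[OF W])
  finally have "trace (T (V - W) ** W) = 0" by (simp add: trace_zero)
  hence "T (V - W) ** W = 0" using psd_mat_mult_eq_zeroI TU W by blast
  thus ?thesis by (simp add: matrix_mult_diff_right TUV)
qed

text \<open>Strong induction on the rank of \<open>V\<close>: a reducible \<open>V\<close> is cut
  into an invariant \<open>W\<close> and its invariant complement. \<open>sorted_wrt\<close> records
  each product in one order only; the other order follows later by taking adjoints.\<close>

lemma splits_corners_decomposition:
  assumes sa: "self_adjoint_map T" and sp: "splits_corners T"
    and "orth_proj V" "T V ** V = T V"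
  shows "\<exists>Ws. (\<forall>W\<in>set Ws. orth_proj W \<and> W ** V = W \<and> T W ** W = T W \<and> irreducible_on T W) \<and>
    sorted_wrt (\<lambda>A B. A ** B = 0) Ws \<and>
    (\<forall>X. (\<forall>W\<in>set Ws. W ** X ** W = 0) \<longrightarrow> T (V ** X ** V) = 0)"
  using assms(3,4)
proof (induction "vec.dim {x. V *v x = x}" arbitrary: V rule: less_induct)
  case less
  note V = less.prems(1) and TV = less.prems(2)
  show ?case
  proof (cases "irreducible_on T V")
    case True
    thus ?thesis using V TV by (intro exI[of _ "[V]"]) (simp add: orth_proj_idem map_zero)
  next
    case False
    then obtain W where W: "orth_proj W" and WV: "W ** V = W" and TW: "T W ** W = T W"
      and ne: "W \<noteq> 0" "W \<noteq> V"
      unfolding irreducible_on_iff[OF V] by blast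
    have VW: "V ** W = W" using V W WV hermitian_support_left orth_proj_hermitian by blast
    define U where "U = V - W"
    have U: "orth_proj U" unfolding U_def using orth_proj_diff V W WV by blast
    have TU: "T U ** U = T U" unfolding U_def by (rule invariant_complement[OF sa V TV W WV TW])
    have UV: "U ** V = U" by (simp add: U_def matrix_mult_simps WV orth_proj_idem[OF V])
    have UW: "U ** W = 0" and WU: "W ** U = 0"
      by (simp_all add: U_def matrix_mult_simps WV VW orth_proj_idem[OF W])
    have "U \<noteq> V" using ne(1) by (simp add: U_def)
    obtain Ws1 where 1: "\<forall>A\<in>set Ws1. orth_proj A \<and> A ** W = A \<and> T A ** A = T A \<and> irreducible_on T A"
      "sorted_wrt (\<lambda>A B. A ** B = 0) Ws1"
      "\<forall>X. (\<forall>A\<in>set Ws1. A ** X ** A = 0) \<longrightarrow> T (W ** X ** W) = 0"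
      using less.hyps[OF dim_range_orth_proj_less[OF V W WV ne(2)] W TW] by blast
    obtain Ws2 where 2: "\<forall>A\<in>set Ws2. orth_proj A \<and> A ** U = A \<and> T A ** A = T A \<and> irreducible_on T A"
      "sorted_wrt (\<lambda>A B. A ** B = 0) Ws2"
      "\<forall>X. (\<forall>A\<in>set Ws2. A ** X ** A = 0) \<longrightarrow> T (U ** X ** U) = 0"
      using less.hyps[OF dim_range_orth_proj_less[OF V U UV \<open>U \<noteq> V\<close>] U TU] by blast
    show ?thesis
    proof (intro exI[of _ "Ws1 @ Ws2"] conjI)
      have "A ** V = A" if "A \<in> set Ws1" for A using 1(1) that WV by (metis matrix_mul_assoc)
      moreover have "A ** V = A" if "A \<in> set Ws2" for A using 2(1) that UV by (metis matrix_mul_assoc)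
      ultimately show "\<forall>A\<in>set (Ws1 @ Ws2). orth_proj A \<and> A ** V = A \<and> T A ** A = T A \<and> irreducible_on T A"
        using 1(1) 2(1) by auto
      have "A ** B = 0" if A: "A \<in> set Ws1" and B: "B \<in> set Ws2" for A B
      proof -
        have "U ** B = B"
          using 2(1) B U by (intro hermitian_support_left orth_proj_hermitian) auto
        moreover have "A ** W = A" using 1(1) A by blast
        ultimately have "A ** B = A ** (W ** U) ** B" by (metis matrix_mul_assoc)
        thus ?thesis by (simp add: WU matrix_mult_simps)
      qed
      thus "sorted_wrt (\<lambda>A B. A ** B = 0) (Ws1 @ Ws2)" using 1(2) 2(2) by (simp add: sorted_wrt_append)
      show "\<forall>X. (\<forall>A\<in>set (Ws1 @ Ws2). A ** X ** A = 0) \<longrightarrow> T (V ** X ** V) = 0"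
      proof (intro allI impI)
        fix X assume X: "\<forall>A\<in>set (Ws1 @ Ws2). A ** X ** A = 0"
        \<comment> \<open>The diagonal blocks are handled by induction, the off-diagonal ones by the
          splitting of \<open>W\<close> and of \<open>U\<close>.\<close>
        have "V ** X ** V = W ** X ** W + U ** X ** U + W ** X ** U + U ** X ** W"
          by (simp add: U_def matrix_mult_simps)
        moreover have "T (W ** X ** W) = 0" "T (U ** X ** U) = 0" using 1(3) 2(3) X by auto
        moreover have "T (W ** X ** U) = 0"
        proof -
          have "W ** X ** U = W ** (X ** U) ** (mat 1 - W)"
            by (simp add: matrix_mult_simps matrix_mul_assoc)
               (simp add: UW matrix_mult_simps flip: matrix_mul_assoc)
          thus ?thesis using sp W TW by (simp add: splits_corners_def)
        qed
        moreover have "T (U ** X ** W) = 0"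
        proof -
          have "U ** X ** W = U ** (X ** W) ** (mat 1 - U)"
            by (simp add: matrix_mult_simps matrix_mul_assoc)
               (simp add: WU matrix_mult_simps flip: matrix_mul_assoc)
          thus ?thesis using sp U TU by (simp add: splits_corners_def)
        qed
        ultimately show "T (V ** X ** V) = 0" by (simp add: map_add)
      qed
    qed
  qed
qed

lemma splits_corners_imp_completely_reducible:
  assumes sa: "self_adjoint_map T" and sp: "splits_corners T"
  shows "completely_reducible T"
proof -
  obtain Ws where Ws: "\<And>W. W \<in> set Ws \<Longrightarrow> orth_proj W \<and> T W ** W = T W \<and> irreducible_on T W"
    "sorted_wrt (\<lambda>A B. A ** B = 0) Ws"
    "\<And>X. (\<And>W. W \<in> set Ws \<Longrightarrow> W ** X ** W = 0) \<Longrightarrow> T X = 0"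
    using splits_corners_decomposition[OF sa sp orth_proj_mat_1] by (auto simp: Ball_def)
  have orth: "Ws ! i ** Ws ! j = 0" if "i < length Ws" "j < length Ws" "i \<noteq> j" for i j
  proof (cases "i < j")
    case True
    thus ?thesis using Ws(2) that by (simp add: sorted_wrt_iff_nth_less)
  next
    case False
    hence "Ws ! j ** Ws ! i = 0" using Ws(2) that by (simp add: sorted_wrt_iff_nth_less)
    hence "adj_mat (Ws ! j ** Ws ! i) = 0" by (simp add: adj_mat_zero)
    thus ?thesis using Ws(1)[OF nth_mem[OF that(1)]] Ws(1)[OF nth_mem[OF that(2)]]
      by (simp add: adj_mat_mult orth_proj_def hermitian_mat_def)
  qed
  have "T X = 0" if X: "\<forall>i<length Ws. \<forall>Y\<in>corner (Ws ! i) (Ws ! i). tr_inner X Y = 0" for X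
  proof (rule Ws(3))
    fix W assume "W \<in> set Ws"
    hence W: "orth_proj W" and orthX: "\<forall>Y\<in>corner W W. tr_inner X Y = 0"
      using Ws(1) X by (auto simp: in_set_conv_nth)
    \<comment> \<open>Testing \<open>X\<close> against its own compression gives the squared
      Frobenius norm of that compression.\<close>
    let ?K = "W ** X ** W"
    have K: "?K \<in> corner W W" by (auto simp: corner_def)
    hence "W ** ?K ** W = ?K" using mem_corner_iff[OF W] by metis
    hence "tr_inner X ?K = tr_inner ?K ?K"
      using tr_inner_corner[OF orth_proj_hermitian[OF W], of X ?K] by (simp add: tr_inner_def)
    thus "?K = 0" using orthX K tr_inner_self_eq_0 by metis
  qed
  thus ?thesis
    unfolding completely_reducible_def using sa positive Ws(1) orth corner_invariant_iff
    by (intro conjI exI[of _ Ws]) auto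
qed

end

section \<open>The maps of a state\<close>

lemma G_map_simps:
  shows G_map_add: "G_map \<gamma> (X + Y) = G_map \<gamma> X + G_map \<gamma> Y"
    and G_map_smult: "G_map \<gamma> (mat c ** X) = mat c ** G_map \<gamma> X"
    and G_map_scaleR: "G_map \<gamma> (r *\<^sub>R X) = r *\<^sub>R G_map \<gamma> X"
    and G_map_zero: "G_map \<gamma> 0 = 0"
    and G_map_add_state: "G_map (\<gamma> + \<delta>) X = G_map \<gamma> X + G_map \<delta> X"
    and G_map_scaleR_state: "G_map (r *\<^sub>R \<gamma>) X = r *\<^sub>R G_map \<gamma> X"
  by (simp_all add: G_map_def vec_eq_iff mat_mult_entry algebra_simps sum.distrib
      sum_distrib_left scaleR_sum_right)

lemma F_map_simps:
  shows F_map_add: "F_map \<gamma> (X + Y) = F_map \<gamma> X + F_map \<gamma> Y"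
    and F_map_smult: "F_map \<gamma> (mat c ** X) = mat c ** F_map \<gamma> X"
    and F_map_scaleR: "F_map \<gamma> (r *\<^sub>R X) = r *\<^sub>R F_map \<gamma> X"
    and F_map_zero: "F_map \<gamma> 0 = 0"
    and F_map_add_state: "F_map (\<gamma> + \<delta>) X = F_map \<gamma> X + F_map \<delta> X"
    and F_map_scaleR_state: "F_map (r *\<^sub>R \<gamma>) X = r *\<^sub>R F_map \<gamma> X"
  by (simp_all add: F_map_def vec_eq_iff mat_mult_entry algebra_simps sum.distrib
      sum_distrib_left scaleR_sum_right)

text \<open>The two maps are transposes of each other for the bilinear trace pairing.
  Self-adjointness, the kernel identity and the transfer of quadratic forms all rest on
  this.\<close>

lemma trace_F_map_mult: "trace (F_map \<gamma> Y ** X) = trace (Y ** G_map \<gamma> X)"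
proof -
  let ?t = "\<lambda>a b j l. \<gamma> $ (a, j) $ (b, l) * Y $ l $ j * X $ b $ a"
  have "trace (F_map \<gamma> Y ** X) = (\<Sum>a\<in>UNIV. \<Sum>b\<in>UNIV. \<Sum>j\<in>UNIV. \<Sum>l\<in>UNIV. ?t a b j l)"
    by (simp add: trace_def matrix_matrix_mult_def F_map_def sum_distrib_right)
  also have "\<dots> = (\<Sum>a\<in>UNIV. \<Sum>j\<in>UNIV. \<Sum>b\<in>UNIV. \<Sum>l\<in>UNIV. ?t a b j l)"
    by (intro sum.cong refl, rule sum.swap)
  also have "\<dots> = (\<Sum>j\<in>UNIV. \<Sum>a\<in>UNIV. \<Sum>b\<in>UNIV. \<Sum>l\<in>UNIV. ?t a b j l)"
    by (rule sum.swap)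
  also have "\<dots> = (\<Sum>j\<in>UNIV. \<Sum>a\<in>UNIV. \<Sum>l\<in>UNIV. \<Sum>b\<in>UNIV. ?t a b j l)"
    by (intro sum.cong refl, rule sum.swap)
  also have "\<dots> = (\<Sum>j\<in>UNIV. \<Sum>l\<in>UNIV. \<Sum>a\<in>UNIV. \<Sum>b\<in>UNIV. ?t a b j l)"
    by (intro sum.cong refl, rule sum.swap)
  also have "\<dots> = (\<Sum>l\<in>UNIV. \<Sum>j\<in>UNIV. \<Sum>a\<in>UNIV. \<Sum>b\<in>UNIV. ?t a b j l)"
    by (rule sum.swap)
  also have "\<dots> = trace (Y ** G_map \<gamma> X)"
    by (simp add: trace_def matrix_matrix_mult_def G_map_def sum_distrib_left mult_ac)
  finally show ?thesis .
qed

lemma hermitian_mat_entry: "hermitian_mat A \<Longrightarrow> cnj (A $ i $ j) = A $ j $ i"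
  by (simp add: hermitian_mat_def adj_mat_def vec_eq_iff)

lemma adj_mat_G_map: "hermitian_mat \<gamma> \<Longrightarrow> adj_mat (G_map \<gamma> X) = G_map \<gamma> (adj_mat X)"
  by (simp add: adj_mat_def G_map_def vec_eq_iff hermitian_mat_entry) (intro allI, rule sum.swap)

lemma adj_mat_F_map: "hermitian_mat \<gamma> \<Longrightarrow> adj_mat (F_map \<gamma> X) = F_map \<gamma> (adj_mat X)"
  by (simp add: adj_mat_def F_map_def vec_eq_iff hermitian_mat_entry) (intro allI, rule sum.swap)

lemma hermitian_G_map: "hermitian_mat \<gamma> \<Longrightarrow> hermitian_mat X \<Longrightarrow> hermitian_mat (G_map \<gamma> X)"
  by (metis adj_mat_G_map hermitian_mat_def)

lemma hermitian_F_map: "hermitian_mat \<gamma> \<Longrightarrow> hermitian_mat Y \<Longrightarrow> hermitian_mat (F_map \<gamma> Y)"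
  by (metis adj_mat_F_map hermitian_mat_def)

section \<open>Product vectors and positivity of the two maps\<close>

definition tensor_vec :: "complex^'k::finite \<Rightarrow> complex^'m::finite \<Rightarrow> complex^('k \<times> 'm)" where
  "tensor_vec v y = (\<chi> p. v $ fst p * y $ snd p)"

lemma tensor_vec_nonzero: "v \<noteq> 0 \<Longrightarrow> y \<noteq> 0 \<Longrightarrow> tensor_vec v y \<noteq> 0"
  by (auto simp: tensor_vec_def vec_eq_iff)

lemma sum_UNIV_prod: "(\<Sum>p\<in>(UNIV :: ('a::finite \<times> 'b::finite) set). f p) = (\<Sum>a\<in>UNIV. \<Sum>b\<in>UNIV. f (a, b))"
  by (simp add: sum.cartesian_product UNIV_Times_UNIV[symmetric] del: UNIV_Times_UNIV)

lemma quad_form_F_map_outer: "quad_form (F_map \<gamma> (outer y)) v = quad_form \<gamma> (tensor_vec v y)"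
proof -
  let ?t = "\<lambda>a b j l. cnj (v $ a) * cnj (y $ j) * \<gamma> $ (a, j) $ (b, l) * v $ b * y $ l"
  have "quad_form (F_map \<gamma> (outer y)) v = (\<Sum>a\<in>UNIV. \<Sum>b\<in>UNIV. \<Sum>j\<in>UNIV. \<Sum>l\<in>UNIV. ?t a b j l)"
    by (simp add: quad_form_def matrix_vector_mult_def F_map_def outer_def sum_distrib_left
        sum_distrib_right mult_ac)
  also have "\<dots> = (\<Sum>a\<in>UNIV. \<Sum>j\<in>UNIV. \<Sum>b\<in>UNIV. \<Sum>l\<in>UNIV. ?t a b j l)"
    by (intro sum.cong refl, rule sum.swap)
  also have "\<dots> = quad_form \<gamma> (tensor_vec v y)"
    by (simp add: quad_form_def matrix_vector_mult_def tensor_vec_def sum_UNIV_prod sum_distrib_left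
        sum_distrib_right mult_ac)
  finally show ?thesis .
qed

lemma quad_form_G_map: "quad_form (G_map \<gamma> X) y = trace (F_map \<gamma> (outer y) ** X)"
  by (metis trace_F_map_mult trace_mul_sym trace_mult_outer)

lemma quad_form_F_map: "quad_form (F_map \<gamma> Y) v = trace (Y ** G_map \<gamma> (outer v))"
  by (metis trace_F_map_mult trace_mult_outer)

lemma psd_F_map_outer: "psd_mat \<gamma> \<Longrightarrow> psd_mat (F_map \<gamma> (outer y))"
  by (simp add: psd_mat_def quad_form_F_map_outer hermitian_F_map hermitian_mat_outer)

lemma pd_F_map_outer: "pd_mat \<gamma> \<Longrightarrow> y \<noteq> 0 \<Longrightarrow> pd_mat (F_map \<gamma> (outer y))"
  by (simp add: pd_mat_def quad_form_F_map_outer hermitian_F_map hermitian_mat_outer tensor_vec_nonzero)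

text \<open>The form of the image at y is the trace of a product of two positive matrices,
  \<open>F_map \<gamma> (outer y)\<close> and \<open>X\<close>.\<close>

lemma psd_G_map: "psd_mat \<gamma> \<Longrightarrow> psd_mat X \<Longrightarrow> psd_mat (G_map \<gamma> X)"
  unfolding psd_mat_def[of "G_map \<gamma> X"] quad_form_G_map
  by (intro conjI allI hermitian_G_map trace_mult_psd_nonneg psd_F_map_outer psd_mat_hermitian)

lemma psd_F_map: "psd_mat \<gamma> \<Longrightarrow> psd_mat Y \<Longrightarrow> psd_mat (F_map \<gamma> Y)"
  unfolding psd_mat_def[of "F_map \<gamma> Y"] quad_form_F_map
  by (intro conjI allI hermitian_F_map trace_mult_psd_nonneg psd_G_map psd_mat_outer psd_mat_hermitian)

lemma linear_positive_map_state:
  assumes "psd_mat \<gamma>"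
  shows "linear_positive_map (F_map \<gamma> \<circ> G_map \<gamma>)"
  using assms
  by unfold_locales
     (auto simp: G_map_simps F_map_simps positive_map_def psd_F_map psd_G_map)

lemma self_adjoint_state:
  assumes "hermitian_mat \<gamma>"
  shows "self_adjoint_map (F_map \<gamma> \<circ> G_map \<gamma>)"
  unfolding self_adjoint_map_def
proof (intro allI)
  fix X Y
  have "tr_inner X (F_map \<gamma> (G_map \<gamma> Y)) = trace (X ** F_map \<gamma> (G_map \<gamma> (adj_mat Y)))"
    by (simp add: tr_inner_def adj_mat_F_map adj_mat_G_map assms)
  also have "\<dots> = trace (G_map \<gamma> X ** G_map \<gamma> (adj_mat Y))"
    by (metis trace_F_map_mult trace_mul_sym)
  also have "\<dots> = tr_inner (F_map \<gamma> (G_map \<gamma> X)) Y"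
    by (simp add: tr_inner_def trace_F_map_mult)
  finally show "tr_inner ((F_map \<gamma> \<circ> G_map \<gamma>) X) Y = tr_inner X ((F_map \<gamma> \<circ> G_map \<gamma>) Y)" by simp
qed

text \<open>Pairing F(G(X)) with the adjoint of X yields the squared Frobenius norm of G(X).\<close>

lemma F_map_G_map_eq_zero_iff:
  assumes "hermitian_mat \<gamma>"
  shows "F_map \<gamma> (G_map \<gamma> X) = 0 \<longleftrightarrow> G_map \<gamma> X = 0"
proof
  assume "F_map \<gamma> (G_map \<gamma> X) = 0"
  hence "trace (G_map \<gamma> X ** G_map \<gamma> (adj_mat X)) = 0"
    by (simp add: matrix_mult_simps trace_zero flip: trace_F_map_mult)
  hence "tr_inner (G_map \<gamma> X) (G_map \<gamma> X) = 0"
    by (simp add: tr_inner_def adj_mat_G_map assms)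
  thus "G_map \<gamma> X = 0" by (simp add: tr_inner_self_eq_0)
qed (simp add: F_map_zero)

text \<open>\<open>G_map\<close> is additive in \<gamma>, whereas the composite map is quadratic in
  it. Stating the conclusion through \<open>G_map\<close> lets it pass to sums.\<close>

lemma CR_iff:
  "\<gamma> \<in> CR \<longleftrightarrow> psd_mat \<gamma> \<and>
    (\<forall>V. orth_proj V \<longrightarrow> F_map \<gamma> (G_map \<gamma> V) ** V = F_map \<gamma> (G_map \<gamma> V) \<longrightarrow>
      (\<forall>X. G_map \<gamma> (V ** X ** (mat 1 - V)) = 0))"
proof (cases "psd_mat \<gamma>")
  case True
  interpret linear_positive_map "F_map \<gamma> \<circ> G_map \<gamma>" by (rule linear_positive_map_state[OF True])
  have h: "hermitian_mat \<gamma>" using True psd_mat_hermitian by blast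
  have "completely_reducible (F_map \<gamma> \<circ> G_map \<gamma>) \<longleftrightarrow> splits_corners (F_map \<gamma> \<circ> G_map \<gamma>)"
    using completely_reducible_imp_splits_corners splits_corners_imp_completely_reducible
      self_adjoint_state[OF h] by blast
  thus ?thesis by (simp add: CR_def True splits_corners_def F_map_G_map_eq_zero_iff[OF h])
qed (simp add: CR_def)

section \<open>The cone of completely reducible states\<close>

lemma pd_invariant_orth_proj_trivial:
  assumes pd: "pd_mat \<gamma>" and V: "orth_proj V"
    and TV: "F_map \<gamma> (G_map \<gamma> V) ** V = F_map \<gamma> (G_map \<gamma> V)"
  shows "V = 0 \<or> V = mat 1"
proof (rule ccontr)
  assume ne: "\<not> (V = 0 \<or> V = mat 1)"
  then obtain x where x: "V *v x \<noteq> x" by (metis matrix_eq matrix_vector_mul_lid)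
  define z where "z = x - V *v x"
  have z: "z \<noteq> 0" using x by (simp add: z_def)
  have psd: "psd_mat (G_map \<gamma> V)" using pd V pd_imp_psd_mat psd_G_map orth_proj_psd by blast
  have "G_map \<gamma> V \<noteq> 0"
  proof
    assume "G_map \<gamma> V = 0"
    hence "trace (F_map \<gamma> (outer (axis i 1)) ** V) = 0" for i
      by (simp add: quad_form_cip cip_simps flip: quad_form_G_map)
    moreover have "0 < Re (trace (F_map \<gamma> (outer (axis i 1)) ** V))" for i
      using ne V by (intro trace_mult_pd_pos pd_F_map_outer orth_proj_psd pd) auto
    ultimately show False by simp
  qed
  moreover have "pd_mat (G_map \<gamma> (outer z))"
    unfolding pd_mat_def
  proof (intro conjI allI impI)
    show "hermitian_mat (G_map \<gamma> (outer z))"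
      using pd pd_imp_psd_mat psd_G_map psd_mat_outer psd_mat_hermitian by blast
    show "0 < Re (quad_form (G_map \<gamma> (outer z)) y)" if "y \<noteq> 0" for y
      using pd_F_map_outer[OF pd that] z by (simp add: quad_form_G_map trace_mult_outer pd_mat_def)
  qed
  ultimately have "0 < Re (trace (G_map \<gamma> (outer z) ** G_map \<gamma> V))"
    using psd by (intro trace_mult_pd_pos)
  also have "trace (G_map \<gamma> (outer z) ** G_map \<gamma> V) = quad_form (F_map \<gamma> (G_map \<gamma> V)) z"
    by (metis quad_form_F_map trace_mul_sym)
  also have "F_map \<gamma> (G_map \<gamma> V) *v z = 0"
    by (simp add: z_def algebra_simps matrix_vector_mul_assoc TV)
  hence "quad_form (F_map \<gamma> (G_map \<gamma> V)) z = 0" by (simp add: quad_form_cip cip_simps)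
  finally show False by simp
qed

lemma pd_mat_in_CR: "pd_mat \<gamma> \<Longrightarrow> \<gamma> \<in> CR"
  unfolding CR_iff using pd_invariant_orth_proj_trivial[of \<gamma>] pd_imp_psd_mat
  by (fastforce simp: matrix_mult_simps G_map_zero)

section \<open>Cone properties and density\<close>

lemma CR_scaleR:
  assumes "\<gamma> \<in> CR" "c > 0"
  shows "c *\<^sub>R \<gamma> \<in> CR"
  unfolding CR_iff
proof (intro conjI allI impI)
  show "psd_mat (c *\<^sub>R \<gamma>)" using assms by (simp add: CR_iff psd_mat_scaleR)
  fix V X
  assume V: "orth_proj V"
    and "F_map (c *\<^sub>R \<gamma>) (G_map (c *\<^sub>R \<gamma>) V) ** V = F_map (c *\<^sub>R \<gamma>) (G_map (c *\<^sub>R \<gamma>) V)"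
  hence "(c * c) *\<^sub>R (F_map \<gamma> (G_map \<gamma> V) ** V) = (c * c) *\<^sub>R F_map \<gamma> (G_map \<gamma> V)"
    by (simp add: G_map_simps F_map_simps scalar_matrix_assoc)
  hence "F_map \<gamma> (G_map \<gamma> V) ** V = F_map \<gamma> (G_map \<gamma> V)" using assms(2) by simp
  thus "G_map (c *\<^sub>R \<gamma>) (V ** X ** (mat 1 - V)) = 0"
    using assms(1) V by (simp add: CR_iff G_map_simps)
qed

lemma CR_add:
  assumes \<gamma>: "\<gamma> \<in> CR" and \<delta>: "\<delta> \<in> CR"
  shows "\<gamma> + \<delta> \<in> CR"
  unfolding CR_iff
proof (intro conjI allI impI)
  have psd: "psd_mat \<gamma>" "psd_mat \<delta>" using assms by (simp_all add: CR_iff)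
  thus "psd_mat (\<gamma> + \<delta>)" by (rule psd_mat_add)
  fix V X
  assume V: "orth_proj V"
    and TV: "F_map (\<gamma> + \<delta>) (G_map (\<gamma> + \<delta>) V) ** V = F_map (\<gamma> + \<delta>) (G_map (\<gamma> + \<delta>) V)"
  note psds = psd_F_map psd_G_map orth_proj_psd[OF V] psd psd_mat_add
  \<comment> \<open>Expanding both maps in the state gives four positive terms; taking away one
    leaves a sum of three.\<close>
  have "psd_mat (F_map (\<gamma> + \<delta>) (G_map (\<gamma> + \<delta>) V) - F_map \<gamma> (G_map \<gamma> V))"
    using psd_mat_add[of "F_map \<gamma> (G_map \<delta> V)" "F_map \<delta> (G_map \<gamma> V) + F_map \<delta> (G_map \<delta> V)"]
    by (simp add: psds G_map_simps F_map_simps algebra_simps)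
  hence "F_map \<gamma> (G_map \<gamma> V) ** V = F_map \<gamma> (G_map \<gamma> V)"
    by (intro psd_mat_le_support[OF _ _ TV] psds)
  moreover have "psd_mat (F_map (\<gamma> + \<delta>) (G_map (\<gamma> + \<delta>) V) - F_map \<delta> (G_map \<delta> V))"
    using psd_mat_add[of "F_map \<gamma> (G_map \<delta> V)" "F_map \<delta> (G_map \<gamma> V) + F_map \<gamma> (G_map \<gamma> V)"]
    by (simp add: psds G_map_simps F_map_simps algebra_simps)
  hence "F_map \<delta> (G_map \<delta> V) ** V = F_map \<delta> (G_map \<delta> V)"
    by (intro psd_mat_le_support[OF _ _ TV] psds)
  ultimately show "G_map (\<gamma> + \<delta>) (V ** X ** (mat 1 - V)) = 0"
    using \<gamma> \<delta> V by (simp add: CR_iff G_map_simps)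
qed

lemma states_subset_closure_CR: "(states :: ('k::finite \<times> 'm::finite) cmat set) \<subseteq> closure CR"
proof
  fix \<gamma> :: "('k \<times> 'm) cmat"
  assume "\<gamma> \<in> states"
  hence psd: "psd_mat \<gamma>" by (simp add: states_def)
  define s where "s = (\<lambda>n. \<gamma> + inverse (real (Suc n)) *\<^sub>R mat 1)"
  have "s n \<in> CR" for n
  proof (rule pd_mat_in_CR)
    have "0 < Re (quad_form (s n) x)" if "x \<noteq> 0" for x
    proof -
      have "0 < inverse (real (Suc n)) * (norm x)\<^sup>2" using that by simp
      moreover have "0 \<le> Re (quad_form \<gamma> x)" using psd by (simp add: psd_mat_def)
      moreover have "Re (quad_form (s n) x) = Re (quad_form \<gamma> x) + inverse (real (Suc n)) * (norm x)\<^sup>2"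
        unfolding s_def quad_form_simps of_real_mult[symmetric] by (simp only: plus_complex.simps Re_complex_of_real)
      ultimately show ?thesis by linarith
    qed
    moreover have "hermitian_mat (s n)"
      unfolding s_def by (intro hermitian_mat_simps psd_mat_hermitian psd)
    ultimately show "pd_mat (s n)" by (simp add: pd_mat_def)
  qed
  moreover have "s \<longlonglongrightarrow> \<gamma> + 0 *\<^sub>R mat 1"
    unfolding s_def by (intro tendsto_intros LIMSEQ_inverse_real_of_nat)
  ultimately show "\<gamma> \<in> closure CR" by (auto simp: closure_sequential)
qed

section \<open>Matrix units and a maximally entangled state\<close>

definition mat_unit :: "'k::finite \<Rightarrow> 'k \<Rightarrow> 'k cmat" where
  "mat_unit a b = (\<chi> i j. if i = a then if j = b then 1 else 0 else 0)"

lemma G_map_mat_unit: "G_map \<gamma> (mat_unit a b) = (\<chi> j l. \<gamma> $ (b, j) $ (a, l))"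
  by (simp add: G_map_def mat_unit_def if_distrib[of "\<lambda>x. _ * x"] cong: if_cong)

lemma F_map_mat_unit: "F_map \<gamma> (mat_unit j l) = (\<chi> a b. \<gamma> $ (a, l) $ (b, j))"
  by (simp add: F_map_def mat_unit_def if_distrib[of "\<lambda>x. _ * x"] cong: if_cong)

lemma mat_unit_mult: "mat_unit a b ** mat_unit c d = (if b = c then mat_unit a d else 0)"
  by (auto simp: mat_unit_def matrix_matrix_mult_def vec_eq_iff if_distrib[of "\<lambda>x. x * _"] cong: if_cong)

lemma orth_proj_mat_unit: "orth_proj (mat_unit a a)"
  by (simp add: orth_proj_def mat_unit_mult)
     (auto simp: hermitian_mat_def adj_mat_def vec_eq_iff mat_unit_def)

text \<open>On the two-dimensional blocks spanned by \<open>a, b\<close> and \<open>j, l\<close>, the map \<open>F\<^sub>\<gamma> \<circ> G\<^sub>\<gamma>\<close> is the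
  identity, so all their corners are invariant, but proper ones do not split off.\<close>

lemma maximally_entangled_not_in_CR:
  fixes a b :: "'k::finite" and j l :: "'m::finite"
  assumes "a \<noteq> b" "j \<noteq> l"
  shows "outer (axis (a, j) 1 + axis (b, l) 1) \<notin> CR"
proof
  let ?\<gamma> = "outer (axis (a, j) 1 + axis (b, l) 1) :: ('k \<times> 'm) cmat"
  assume CR: "?\<gamma> \<in> CR"
  have G: "G_map ?\<gamma> (mat_unit a a) = mat_unit j j"
    using assms by (auto simp: G_map_mat_unit) (auto simp: mat_unit_def outer_def axis_def vec_eq_iff)
  have F: "F_map ?\<gamma> (mat_unit j j) = mat_unit a a"
    using assms by (auto simp: F_map_mat_unit) (auto simp: mat_unit_def outer_def axis_def vec_eq_iff)
  \<comment> \<open>\<open>mat_unit a a\<close> is invariant, since the two maps carry it to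
    \<open>mat_unit j j\<close> and back. Splitting would annihilate \<open>mat_unit a b\<close>,
    which lies in its off-diagonal block.\<close>
  have "G_map ?\<gamma> (mat_unit a a ** mat_unit a b ** (mat 1 - mat_unit a a)) = 0"
    using CR[unfolded CR_iff, THEN conjunct2, rule_format, OF orth_proj_mat_unit[of a]]
    by (simp add: G F orth_proj_idem[OF orth_proj_mat_unit])
  hence "G_map ?\<gamma> (mat_unit a b) = 0"
    using assms by (simp add: mat_unit_mult matrix_mult_simps)
  \<comment> \<open>This entry is the coefficient of the state at row (b, l) and column (a, j),
    which is 1.\<close>
  hence "G_map ?\<gamma> (mat_unit a b) $ l $ j = 0" by simp
  thus False using assms by (simp add: G_map_mat_unit outer_def axis_def)
qed

text \<open>A closed set that is dense in the states would contain every state, including the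
  entangled one. The dimension bounds supply the two distinct indices in each factor; if k = 1 or m
  = 1, every state lies in \<open>CR\<close>.\<close>

lemma CR_not_closed:
  assumes "CARD('k::finite) \<ge> 2" "CARD('m::finite) \<ge> 2"
  shows "\<not> closed (CR :: ('k \<times> 'm) cmat set)"
proof
  assume "closed (CR :: ('k \<times> 'm) cmat set)"
  hence sub: "states \<subseteq> (CR :: ('k \<times> 'm) cmat set)"
    using states_subset_closure_CR by (metis closure_closed)
  obtain a b :: 'k where "a \<noteq> b"
    using assms(1) by (metis UNIV_I card_le_Suc0_iff_eq finite not_less_eq_eq numeral_2_eq_2)
  moreover obtain j l :: 'm where "j \<noteq> l"
    using assms(2) by (metis UNIV_I card_le_Suc0_iff_eq finite not_less_eq_eq numeral_2_eq_2)
  ultimately have "outer (axis (a, j) 1 + axis (b, l) 1) \<notin> (CR :: ('k \<times> 'm) cmat set)"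
    by (rule maximally_entangled_not_in_CR)
  moreover have "outer x \<in> (states :: ('k \<times> 'm) cmat set)" for x
    by (simp add: states_def psd_mat_outer)
  ultimately show False using sub by blast
qed

theorem mainTheorem7:
  shows "{\<gamma> :: ('k::finite \<times> 'm::finite) cmat. pd_mat \<gamma>} \<subseteq> CR
    \<and> (\<forall>\<gamma>\<in>(CR :: ('k \<times> 'm) cmat set). \<forall>c::real. c > 0 \<longrightarrow> c *\<^sub>R \<gamma> \<in> CR)
    \<and> (\<forall>\<gamma>\<in>(CR :: ('k \<times> 'm) cmat set). \<forall>\<delta>\<in>CR. \<gamma> + \<delta> \<in> CR)
    \<and> (states :: ('k \<times> 'm) cmat set) \<subseteq> closure CR
    \<and> (CARD('k) \<ge> 2 \<and> CARD('m) \<ge> 2 \<longrightarrow> \<not> closed (CR :: ('k \<times> 'm) cmat set))"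
  using pd_mat_in_CR CR_scaleR CR_add states_subset_closure_CR CR_not_closed
  by (intro conjI ballI allI impI subsetI) (auto dest: subsetD)

end
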